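(* Let $\mathbb{K}$ be a field. There exist two non-isomorphic associative unital $\mathbb{K}$-algebras $A$ and $B$ such that $$A*\mathbb{K}\langle x\rangle\cong B*\mathbb{K}\langle x\rangle .$$
   Context: $*$ denotes the free product (coproduct) of associative unital $\mathbb{K}$-algebras, and $\mathbb{K}\langle x\rangle=\mathbb{K}[x]$ is the free algebra on one generator. Isomorphisms are of $\mathbb{K}$-algebras. *)

theory Defs
  imports "HOL-Algebra.UnivPoly" "HOL-Algebra.QuotRing"
begin

section \<open>Associative unital algebras\<close>

text \<open>The library locale \<^locale>\<open>algebra\<close> requires the multiplication to be commutative; here it
  need not be, so compatibility with scalars is required in both arguments.\<close>

locale assoc_algebra = module R M + M?: ring M
  for R :: "('k, 'm) ring_scheme" (structure) and M :: "('k, 'a, 'n) module_scheme" (structure) +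
  assumes smult_assoc_left:
      "\<lbrakk>c \<in> carrier R; x \<in> carrier M; y \<in> carrier M\<rbrakk> \<Longrightarrow>
        (c \<odot>\<^bsub>M\<^esub> x) \<otimes>\<^bsub>M\<^esub> y = c \<odot>\<^bsub>M\<^esub> (x \<otimes>\<^bsub>M\<^esub> y)"
    and smult_assoc_right:
      "\<lbrakk>c \<in> carrier R; x \<in> carrier M; y \<in> carrier M\<rbrakk> \<Longrightarrow>
        x \<otimes>\<^bsub>M\<^esub> (c \<odot>\<^bsub>M\<^esub> y) = c \<odot>\<^bsub>M\<^esub> (x \<otimes>\<^bsub>M\<^esub> y)"

text \<open>Homomorphisms preserve the unit, since \<^const>\<open>ring_hom\<close> does.\<close>

definition alg_hom ::
  "('k, 'm) ring_scheme \<Rightarrow> ('k, 'a, 'n) module_scheme \<Rightarrow> ('k, 'b, 'p) module_scheme \<Rightarrow> ('a \<Rightarrow> 'b) set"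
  where "alg_hom K A B =
    {h \<in> ring_hom A B. \<forall>c\<in>carrier K. \<forall>x\<in>carrier A. h (c \<odot>\<^bsub>A\<^esub> x) = c \<odot>\<^bsub>B\<^esub> h x}"

definition alg_isomorphic ::
  "('k, 'm) ring_scheme \<Rightarrow> ('k, 'a, 'n) module_scheme \<Rightarrow> ('k, 'b, 'p) module_scheme \<Rightarrow> bool"
  where "alg_isomorphic K A B \<longleftrightarrow> (\<exists>h\<in>alg_hom K A B. bij_betw h (carrier A) (carrier B))"

section \<open>Free algebras\<close>

text \<open>A noncommutative polynomial is a finitely supported function from the words over \<open>X\<close> to \<open>K\<close>;
  multiplication is convolution with respect to concatenation, every factorization of a word \<open>w\<close> being
  \<open>take i w @ drop i w\<close> for a unique \<open>i \<le> length w\<close>.\<close>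

definition free_algebra :: "('k, 'm) ring_scheme \<Rightarrow> 'x set \<Rightarrow> ('k, 'x list \<Rightarrow> 'k) module"
  where "free_algebra K X =
    \<lparr>carrier = {f. range f \<subseteq> carrier K \<and> finite {w. f w \<noteq> \<zero>\<^bsub>K\<^esub>} \<and> {w. f w \<noteq> \<zero>\<^bsub>K\<^esub>} \<subseteq> lists X},
     mult = (\<lambda>f g w. \<Oplus>\<^bsub>K\<^esub>i\<in>{..length w}. f (take i w) \<otimes>\<^bsub>K\<^esub> g (drop i w)),
     one = (\<lambda>w. if w = [] then \<one>\<^bsub>K\<^esub> else \<zero>\<^bsub>K\<^esub>),
     zero = (\<lambda>w. \<zero>\<^bsub>K\<^esub>),
     add = (\<lambda>f g w. f w \<oplus>\<^bsub>K\<^esub> g w),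
     smult = (\<lambda>c f w. c \<otimes>\<^bsub>K\<^esub> f w)\<rparr>"

definition free_var :: "('k, 'm) ring_scheme \<Rightarrow> 'x \<Rightarrow> 'x list \<Rightarrow> 'k"
  where "free_var K x = (\<lambda>w. if w = [x] then \<one>\<^bsub>K\<^esub> else \<zero>\<^bsub>K\<^esub>)"

section \<open>Quotients and free products\<close>

definition quotient_algebra :: "('k, 'a, 'n) module_scheme \<Rightarrow> 'a set \<Rightarrow> ('k, 'a set) module"
  where "quotient_algebra A I =
    ring.extend (A Quot I) (module.fields (\<lambda>c X. \<Union>x\<in>X. I +>\<^bsub>A\<^esub> (c \<odot>\<^bsub>A\<^esub> x)))"

text \<open>The relations stating that a map \<open>\<iota>\<close> from \<open>A\<close> to an algebra \<open>F\<close> is a homomorphism.\<close>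

definition hom_relations ::
  "('k, 'm) ring_scheme \<Rightarrow> ('k, 'a, 'n) module_scheme \<Rightarrow> ('k, 'f, 'p) module_scheme \<Rightarrow> ('a \<Rightarrow> 'f) \<Rightarrow> 'f set"
  where "hom_relations K A F \<iota> =
    {\<iota> (x \<oplus>\<^bsub>A\<^esub> y) \<ominus>\<^bsub>F\<^esub> (\<iota> x \<oplus>\<^bsub>F\<^esub> \<iota> y) | x y. x \<in> carrier A \<and> y \<in> carrier A} \<union>
    {\<iota> (c \<odot>\<^bsub>A\<^esub> x) \<ominus>\<^bsub>F\<^esub> (c \<odot>\<^bsub>F\<^esub> \<iota> x) | c x. c \<in> carrier K \<and> x \<in> carrier A} \<union>
    {\<iota> (x \<otimes>\<^bsub>A\<^esub> y) \<ominus>\<^bsub>F\<^esub> (\<iota> x \<otimes>\<^bsub>F\<^esub> \<iota> y) | x y. x \<in> carrier A \<and> y \<in> carrier A} \<union>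
    {\<iota> \<one>\<^bsub>A\<^esub> \<ominus>\<^bsub>F\<^esub> \<one>\<^bsub>F\<^esub>}"

text \<open>The free product is presented by the disjoint union of the two carriers as generators, subject
  to the relations making both inclusions homomorphisms. That it is the coproduct is proved below
  (\<open>free_product_universal\<close>).\<close>

abbreviation free_product_generators ::
  "('k, 'm) ring_scheme \<Rightarrow> ('k, 'a, 'n) module_scheme \<Rightarrow> ('k, 'b, 'p) module_scheme \<Rightarrow>
    ('k, ('a + 'b) list \<Rightarrow> 'k) module"
  where "free_product_generators K A B \<equiv> free_algebra K (carrier A <+> carrier B)"

definition free_product_ideal ::
  "('k, 'm) ring_scheme \<Rightarrow> ('k, 'a, 'n) module_scheme \<Rightarrow> ('k, 'b, 'p) module_scheme \<Rightarrow>
    (('a + 'b) list \<Rightarrow> 'k) set"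
  where "free_product_ideal K A B = Idl\<^bsub>free_product_generators K A B\<^esub>
    (hom_relations K A (free_product_generators K A B) (\<lambda>a. free_var K (Inl a)) \<union>
     hom_relations K B (free_product_generators K A B) (\<lambda>b. free_var K (Inr b)))"

definition free_product ::
  "('k, 'm) ring_scheme \<Rightarrow> ('k, 'a, 'n) module_scheme \<Rightarrow> ('k, 'b, 'p) module_scheme \<Rightarrow>
    ('k, (('a + 'b) list \<Rightarrow> 'k) set) module"
  where "free_product K A B =
    quotient_algebra (free_product_generators K A B) (free_product_ideal K A B)"

definition free_product_inl ::
  "('k, 'm) ring_scheme \<Rightarrow> ('k, 'a, 'n) module_scheme \<Rightarrow> ('k, 'b, 'p) module_scheme \<Rightarrow>
    'a \<Rightarrow> (('a + 'b) list \<Rightarrow> 'k) set"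
  where "free_product_inl K A B a =
    free_product_ideal K A B +>\<^bsub>free_product_generators K A B\<^esub> free_var K (Inl a)"

definition free_product_inr ::
  "('k, 'm) ring_scheme \<Rightarrow> ('k, 'a, 'n) module_scheme \<Rightarrow> ('k, 'b, 'p) module_scheme \<Rightarrow>
    'b \<Rightarrow> (('a + 'b) list \<Rightarrow> 'k) set"
  where "free_product_inr K A B b =
    free_product_ideal K A B +>\<^bsub>free_product_generators K A B\<^esub> free_var K (Inr b)"

section \<open>Free algebras are algebras\<close>

lemma free_algebra_simps [simp]:
  "mult (free_algebra K X) f g = (\<lambda>w. \<Oplus>\<^bsub>K\<^esub>i\<in>{..length w}. f (take i w) \<otimes>\<^bsub>K\<^esub> g (drop i w))"
  "one (free_algebra K X) = (\<lambda>w. if w = [] then \<one>\<^bsub>K\<^esub> else \<zero>\<^bsub>K\<^esub>)"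
  "zero (free_algebra K X) = (\<lambda>w. \<zero>\<^bsub>K\<^esub>)"
  "add (free_algebra K X) f g = (\<lambda>w. f w \<oplus>\<^bsub>K\<^esub> g w)"
  "smult (free_algebra K X) c f = (\<lambda>w. c \<otimes>\<^bsub>K\<^esub> f w)"
  by (simp_all add: free_algebra_def)

lemma free_algebra_carrier_iff:
  "f \<in> carrier (free_algebra K X) \<longleftrightarrow>
    (\<forall>w. f w \<in> carrier K) \<and> finite {w. f w \<noteq> \<zero>\<^bsub>K\<^esub>} \<and> (\<forall>w. f w \<noteq> \<zero>\<^bsub>K\<^esub> \<longrightarrow> set w \<subseteq> X)"
  by (auto simp: free_algebra_def in_lists_conv_set)

definition free_mono :: "('k, 'm) ring_scheme \<Rightarrow> 'k \<Rightarrow> 'x list \<Rightarrow> 'x list \<Rightarrow> 'k"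
  where "free_mono K c u = (\<lambda>w. if w = u then c else \<zero>\<^bsub>K\<^esub>)"

context cring
begin

lemma free_mono_carrier: "c \<in> carrier R \<Longrightarrow> set u \<subseteq> X \<Longrightarrow> free_mono R c u \<in> carrier (free_algebra R X)"
  by (auto simp: free_algebra_carrier_iff free_mono_def)

lemma free_val: "f \<in> carrier (free_algebra R X) \<Longrightarrow> f w \<in> carrier R"
  by (simp add: free_algebra_carrier_iff)

lemma free_add_closed:
  assumes "f \<in> carrier (free_algebra R X)" "g \<in> carrier (free_algebra R X)"
  shows "(\<lambda>w. f w \<oplus> g w) \<in> carrier (free_algebra R X)"
proof -
  have "{w. f w \<oplus> g w \<noteq> \<zero>} \<subseteq> {w. f w \<noteq> \<zero>} \<union> {w. g w \<noteq> \<zero>}" by auto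
  then have "finite {w. f w \<oplus> g w \<noteq> \<zero>}"
    using assms by (auto simp: free_algebra_carrier_iff intro: finite_subset)
  then show ?thesis using assms
    unfolding free_algebra_carrier_iff by (metis a_closed l_zero zero_closed)
qed

lemma free_smult_closed:
  assumes "f \<in> carrier (free_algebra R X)" "c \<in> carrier R"
  shows "(\<lambda>w. c \<otimes> f w) \<in> carrier (free_algebra R X)"
proof -
  have "{w. c \<otimes> f w \<noteq> \<zero>} \<subseteq> {w. f w \<noteq> \<zero>}" using assms by auto
  then have "finite {w. c \<otimes> f w \<noteq> \<zero>}"
    using assms by (auto simp: free_algebra_carrier_iff intro: finite_subset)
  then show ?thesis using assms
    unfolding free_algebra_carrier_iff by (metis m_closed r_null)
qed

lemma free_mult_closed:
  assumes f: "f \<in> carrier (free_algebra R X)" and g: "g \<in> carrier (free_algebra R X)"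
  shows "(\<lambda>w. \<Oplus>i\<in>{..length w}. f (take i w) \<otimes> g (drop i w)) \<in> carrier (free_algebra R X)"
    (is "?m \<in> _")
proof -
  have nz: "\<exists>i. f (take i w) \<noteq> \<zero> \<and> g (drop i w) \<noteq> \<zero>" if "?m w \<noteq> \<zero>" for w
  proof (rule ccontr)
    assume n: "\<not> ?thesis"
    have "f (take i w) \<otimes> g (drop i w) = \<zero>" for i
      using n free_val[OF f] free_val[OF g] by (metis l_null r_null)
    then have "?m w = \<zero>" by simp
    with that show False by simp
  qed
  have "w \<in> (\<lambda>(u, v). u @ v) ` ({u. f u \<noteq> \<zero>} \<times> {v. g v \<noteq> \<zero>})" if nzw: "?m w \<noteq> \<zero>" for w
  proof -
    obtain i where "f (take i w) \<noteq> \<zero>" "g (drop i w) \<noteq> \<zero>" using nz[OF nzw] by blast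
    then show ?thesis by (intro image_eqI[of _ _ "(take i w, drop i w)"]) auto
  qed
  then have "{w. ?m w \<noteq> \<zero>} \<subseteq> (\<lambda>(u, v). u @ v) ` ({u. f u \<noteq> \<zero>} \<times> {v. g v \<noteq> \<zero>})" by blast
  moreover have "finite ({u. f u \<noteq> \<zero>} \<times> {v. g v \<noteq> \<zero>})"
    using f g by (simp add: free_algebra_carrier_iff)
  ultimately have "finite {w. ?m w \<noteq> \<zero>}" by (meson finite_surj)
  moreover have "set w \<subseteq> X" if nzw: "?m w \<noteq> \<zero>" for w
  proof -
    obtain i where "f (take i w) \<noteq> \<zero>" "g (drop i w) \<noteq> \<zero>" using nz[OF nzw] by blast
    then have "set (take i w) \<subseteq> X" "set (drop i w) \<subseteq> X"
      using f g by (auto simp: free_algebra_carrier_iff)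
    then show ?thesis by (metis append_take_drop_id set_append Un_least)
  qed
  moreover have "?m w \<in> carrier R" for w
    using free_val[OF f] free_val[OF g] by (intro finsum_closed) auto
  ultimately show ?thesis unfolding free_algebra_carrier_iff by blast
qed

lemma free_induct [consumes 1, case_names zero mono add]:
  assumes f: "f \<in> carrier (free_algebra R X)"
    and z: "P (\<lambda>w. \<zero>)"
    and m: "\<And>c u. c \<in> carrier R \<Longrightarrow> set u \<subseteq> X \<Longrightarrow> P (free_mono R c u)"
    and a: "\<And>f g. f \<in> carrier (free_algebra R X) \<Longrightarrow> g \<in> carrier (free_algebra R X) \<Longrightarrow>
      P f \<Longrightarrow> P g \<Longrightarrow> P (\<lambda>w. f w \<oplus> g w)"
  shows "P f"
proof -
  have fin: "finite {w. f w \<noteq> \<zero>}" using f by (simp add: free_algebra_carrier_iff)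
  have "P f" if "finite S" "f \<in> carrier (free_algebra R X)" "{w. f w \<noteq> \<zero>} \<subseteq> S" for S f
    using that
  proof (induction S arbitrary: f rule: finite_induct)
    case empty
    then have "f = (\<lambda>w. \<zero>)" by auto
    then show ?case using z by simp
  next
    case (insert u S)
    show ?case
    proof (cases "f u = \<zero>")
      case True
      then show ?thesis using insert.IH[of f] insert.prems by auto
    next
      case False
      define g where "g = f(u := \<zero>)"
      have "{w. g w \<noteq> \<zero>} \<subseteq> {w. f w \<noteq> \<zero>}" by (auto simp: g_def)
      then have g: "g \<in> carrier (free_algebra R X)"
        using insert.prems(1) by (auto simp: free_algebra_carrier_iff g_def intro: finite_subset)
      have u: "set u \<subseteq> X" "f u \<in> carrier R"
        using False insert.prems(1) by (auto simp: free_algebra_carrier_iff)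
      have "P g" using insert.prems(2) by (intro insert.IH g) (auto simp: g_def)
      then have "P (\<lambda>w. free_mono R (f u) u w \<oplus> g w)" by (intro a m u g free_mono_carrier)
      moreover have "(\<lambda>w. free_mono R (f u) u w \<oplus> g w) = f"
        using free_val[OF insert.prems(1)] by (auto simp: free_mono_def g_def)
      ultimately show ?thesis by simp
    qed
  qed
  from this[OF fin f] show ?thesis by simp
qed

lemma free_mono_mult:
  assumes "c \<in> carrier R" "d \<in> carrier R"
  shows "free_mono R c u \<otimes>\<^bsub>free_algebra R X\<^esub> free_mono R d v = free_mono R (c \<otimes> d) (u @ v)"
proof
  fix w
  let ?h = "\<lambda>i. free_mono R c u (take i w) \<otimes> free_mono R d v (drop i w)"
  have h0: "?h i = (if length u = i then if w = u @ v then c \<otimes> d else \<zero> else \<zero>)"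
    if "i \<le> length w" for i
  proof -
    have "length u = i" if "take i w = u"
      using that \<open>i \<le> length w\<close> by auto
    moreover have "w = u @ v \<longleftrightarrow> take i w = u \<and> drop i w = v" if "length u = i"
      using that by (metis append_eq_conv_conj)
    ultimately show ?thesis using assms
      by (cases "take i w = u"; cases "drop i w = v"; cases "length u = i") (simp_all add: free_mono_def)
  qed
  have "(\<Oplus>i\<in>{..length w}. ?h i)
      = (\<Oplus>i\<in>{..length w}. if length u = i then if w = u @ v then c \<otimes> d else \<zero> else \<zero>)"
    using assms by (intro add.finprod_cong' h0) simp_all
  also have "\<dots> = free_mono R (c \<otimes> d) (u @ v) w"
  proof (cases "length u \<le> length w")
    case True
    then have "(\<Oplus>i\<in>{..length w}. if length u = i then if w = u @ v then c \<otimes> d else \<zero> else \<zero>)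
        = (if w = u @ v then c \<otimes> d else \<zero>)"
      using assms by (intro add.finprod_singleton) simp_all
    then show ?thesis by (simp add: free_mono_def)
  next
    case False
    then have "(\<Oplus>i\<in>{..length w}. if length u = i then if w = u @ v then c \<otimes> d else \<zero> else \<zero>) = \<zero>"
      by (intro add.finprod_one_eqI) simp
    moreover have "w \<noteq> u @ v" using False by auto
    ultimately show ?thesis by (simp add: free_mono_def)
  qed
  finally show "(free_mono R c u \<otimes>\<^bsub>free_algebra R X\<^esub> free_mono R d v) w = free_mono R (c \<otimes> d) (u @ v) w" by simp
qed

lemma free_l_distr:
  assumes "f \<in> carrier (free_algebra R X)" "g \<in> carrier (free_algebra R X)"
    "h \<in> carrier (free_algebra R X)"
  shows "(\<lambda>w. f w \<oplus> g w) \<otimes>\<^bsub>free_algebra R X\<^esub> h =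
    (\<lambda>w. (f \<otimes>\<^bsub>free_algebra R X\<^esub> h) w \<oplus> (g \<otimes>\<^bsub>free_algebra R X\<^esub> h) w)"
  using assms[THEN free_val] by (auto simp: l_distr finsum_addf)

lemma free_r_distr:
  assumes "f \<in> carrier (free_algebra R X)" "g \<in> carrier (free_algebra R X)"
    "h \<in> carrier (free_algebra R X)"
  shows "h \<otimes>\<^bsub>free_algebra R X\<^esub> (\<lambda>w. f w \<oplus> g w) =
    (\<lambda>w. (h \<otimes>\<^bsub>free_algebra R X\<^esub> f) w \<oplus> (h \<otimes>\<^bsub>free_algebra R X\<^esub> g) w)"
  using assms[THEN free_val] by (auto simp: r_distr finsum_addf)

lemma free_null:
  assumes "f \<in> carrier (free_algebra R X)"
  shows "(\<lambda>w. \<zero>) \<otimes>\<^bsub>free_algebra R X\<^esub> f = (\<lambda>w. \<zero>)" "f \<otimes>\<^bsub>free_algebra R X\<^esub> (\<lambda>w. \<zero>) = (\<lambda>w. \<zero>)"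
  using assms[THEN free_val] by auto

lemma free_m_closed:
  assumes "f \<in> carrier (free_algebra R X)" "g \<in> carrier (free_algebra R X)"
  shows "f \<otimes>\<^bsub>free_algebra R X\<^esub> g \<in> carrier (free_algebra R X)"
  using free_mult_closed[OF assms] by simp

lemma free_m_assoc:
  assumes f: "f \<in> carrier (free_algebra R X)" and g: "g \<in> carrier (free_algebra R X)"
    and h: "h \<in> carrier (free_algebra R X)"
  shows "f \<otimes>\<^bsub>free_algebra R X\<^esub> g \<otimes>\<^bsub>free_algebra R X\<^esub> h =
    f \<otimes>\<^bsub>free_algebra R X\<^esub> (g \<otimes>\<^bsub>free_algebra R X\<^esub> h)"
  using f
proof (induction rule: free_induct)
  case zero
  then show ?case by (simp only: free_null free_m_closed g h)
next
  case (add f1 f2)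
  then show ?case
    by (simp only: free_l_distr free_m_closed g h)
next
  case (mono c u)
  note cu = mono and mc = free_mono_carrier[OF mono]
  show ?case using g
  proof (induction rule: free_induct)
    case zero
    then show ?case by (simp only: free_null h mc)
  next
    case (add g1 g2)
    then show ?case
      by (simp only: free_l_distr free_r_distr free_m_closed h mc)
  next
    case (mono d v)
    note dv = mono and md = free_mono_carrier[OF mono]
    show ?case using h
    proof (induction rule: free_induct)
      case zero
      then show ?case by (simp only: free_null free_m_closed mc md)
    next
      case (add h1 h2)
      then show ?case
        by (simp only: free_r_distr free_m_closed mc md)
    next
      case (mono e x)
      then show ?case using cu dv by (simp only: free_mono_mult m_closed m_assoc append_assoc)
    qed
  qed
qed

lemma free_one_mono: "\<one>\<^bsub>free_algebra R X\<^esub> = free_mono R \<one> []"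
  by (simp add: free_mono_def)

lemma free_one:
  assumes "f \<in> carrier (free_algebra R X)"
  shows "\<one>\<^bsub>free_algebra R X\<^esub> \<otimes>\<^bsub>free_algebra R X\<^esub> f = f \<and>
    f \<otimes>\<^bsub>free_algebra R X\<^esub> \<one>\<^bsub>free_algebra R X\<^esub> = f"
  unfolding free_one_mono using assms
proof (induction rule: free_induct)
  case zero
  have "free_mono R \<one> [] \<in> carrier (free_algebra R X)" by (simp add: free_mono_carrier)
  then show ?case by (simp only: free_null)
next
  case (mono c u)
  then show ?case by (simp only: free_mono_mult one_closed) simp
next
  case (add f g)
  then show ?case using free_mono_carrier[of \<one> "[]" X]
    by (simp only: free_l_distr free_r_distr one_closed list.set empty_subsetI)
qed

lemma free_smult_left:
  assumes "f \<in> carrier (free_algebra R X)" "g \<in> carrier (free_algebra R X)" "c \<in> carrier R"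
  shows "(c \<odot>\<^bsub>free_algebra R X\<^esub> f) \<otimes>\<^bsub>free_algebra R X\<^esub> g =
    c \<odot>\<^bsub>free_algebra R X\<^esub> (f \<otimes>\<^bsub>free_algebra R X\<^esub> g)"
  using assms(3) assms(1,2)[THEN free_val] by (auto simp: finsum_rdistr m_assoc Pi_def)

lemma free_smult_right:
  assumes "f \<in> carrier (free_algebra R X)" "g \<in> carrier (free_algebra R X)" "c \<in> carrier R"
  shows "f \<otimes>\<^bsub>free_algebra R X\<^esub> (c \<odot>\<^bsub>free_algebra R X\<^esub> g) =
    c \<odot>\<^bsub>free_algebra R X\<^esub> (f \<otimes>\<^bsub>free_algebra R X\<^esub> g)"
  using assms(3) assms(1,2)[THEN free_val] by (auto simp: finsum_rdistr m_lcomm Pi_def)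

lemma free_abelian_group: "abelian_group (free_algebra R X)"
proof (rule abelian_groupI)
  fix f assume f: "f \<in> carrier (free_algebra R X)"
  have "(\<lambda>w. (\<ominus> \<one>) \<otimes> f w) \<in> carrier (free_algebra R X)"
    by (intro free_smult_closed f) simp
  moreover have "(\<lambda>w. (\<ominus> \<one>) \<otimes> f w \<oplus> f w) = (\<lambda>w. \<zero>)"
    using free_val[OF f] by (simp add: l_minus l_neg)
  ultimately show "\<exists>g\<in>carrier (free_algebra R X).
      g \<oplus>\<^bsub>free_algebra R X\<^esub> f = \<zero>\<^bsub>free_algebra R X\<^esub>"
    by (intro bexI[of _ "\<lambda>w. (\<ominus> \<one>) \<otimes> f w"]) simp_all
next
  show "\<zero>\<^bsub>free_algebra R X\<^esub> \<in> carrier (free_algebra R X)"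
    by (simp add: free_algebra_carrier_iff)
next
  fix f g h
  assume fgh: "f \<in> carrier (free_algebra R X)" "g \<in> carrier (free_algebra R X)"
    "h \<in> carrier (free_algebra R X)"
  show "f \<oplus>\<^bsub>free_algebra R X\<^esub> g \<oplus>\<^bsub>free_algebra R X\<^esub> h =
      f \<oplus>\<^bsub>free_algebra R X\<^esub> (g \<oplus>\<^bsub>free_algebra R X\<^esub> h)"
    using fgh[THEN free_val] by (simp add: a_assoc)
next
  fix f g
  assume fg: "f \<in> carrier (free_algebra R X)" "g \<in> carrier (free_algebra R X)"
  show "f \<oplus>\<^bsub>free_algebra R X\<^esub> g = g \<oplus>\<^bsub>free_algebra R X\<^esub> f"
    using fg[THEN free_val] by (simp add: a_comm)
qed (auto simp: free_add_closed free_val)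

lemma free_ring: "ring (free_algebra R X)"
proof (rule ringI)
  show "Group.monoid (free_algebra R X)"
  proof (rule monoidI)
    show "\<one>\<^bsub>free_algebra R X\<^esub> \<in> carrier (free_algebra R X)"
      unfolding free_one_mono by (simp add: free_mono_carrier)
  qed (use free_m_closed free_m_assoc free_one in blast)+
next
  fix f g h
  assume fgh: "f \<in> carrier (free_algebra R X)" "g \<in> carrier (free_algebra R X)"
    "h \<in> carrier (free_algebra R X)"
  show "(f \<oplus>\<^bsub>free_algebra R X\<^esub> g) \<otimes>\<^bsub>free_algebra R X\<^esub> h =
      f \<otimes>\<^bsub>free_algebra R X\<^esub> h \<oplus>\<^bsub>free_algebra R X\<^esub> g \<otimes>\<^bsub>free_algebra R X\<^esub> h"
    using free_l_distr[OF fgh] by (simp only: free_algebra_simps(4))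
  show "h \<otimes>\<^bsub>free_algebra R X\<^esub> (f \<oplus>\<^bsub>free_algebra R X\<^esub> g) =
      h \<otimes>\<^bsub>free_algebra R X\<^esub> f \<oplus>\<^bsub>free_algebra R X\<^esub> h \<otimes>\<^bsub>free_algebra R X\<^esub> g"
    using free_r_distr[OF fgh] by (simp only: free_algebra_simps(4))
qed (rule free_abelian_group)

lemma free_module: "module R (free_algebra R X)"
proof (rule moduleI)
  show "cring R" by (rule is_cring)
  show "abelian_group (free_algebra R X)" by (rule free_abelian_group)
next
  fix c f
  assume c: "c \<in> carrier R" and f: "f \<in> carrier (free_algebra R X)"
  show "c \<odot>\<^bsub>free_algebra R X\<^esub> f \<in> carrier (free_algebra R X)"
    using free_smult_closed[OF f c] by simp
next
  fix f
  assume f: "f \<in> carrier (free_algebra R X)"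
  show "\<one> \<odot>\<^bsub>free_algebra R X\<^esub> f = f" using free_val[OF f] by simp
next
  fix c d f
  assume "c \<in> carrier R" "d \<in> carrier R" and f: "f \<in> carrier (free_algebra R X)"
  then show "(c \<oplus> d) \<odot>\<^bsub>free_algebra R X\<^esub> f =
      c \<odot>\<^bsub>free_algebra R X\<^esub> f \<oplus>\<^bsub>free_algebra R X\<^esub> d \<odot>\<^bsub>free_algebra R X\<^esub> f"
    and "(c \<otimes> d) \<odot>\<^bsub>free_algebra R X\<^esub> f =
      c \<odot>\<^bsub>free_algebra R X\<^esub> (d \<odot>\<^bsub>free_algebra R X\<^esub> f)"
    using free_val[OF f] by (simp_all add: l_distr m_assoc)
next
  fix c f g
  assume "c \<in> carrier R" and f: "f \<in> carrier (free_algebra R X)" and g: "g \<in> carrier (free_algebra R X)"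
  then show "c \<odot>\<^bsub>free_algebra R X\<^esub> (f \<oplus>\<^bsub>free_algebra R X\<^esub> g) =
      c \<odot>\<^bsub>free_algebra R X\<^esub> f \<oplus>\<^bsub>free_algebra R X\<^esub> c \<odot>\<^bsub>free_algebra R X\<^esub> g"
    using free_val[OF f] free_val[OF g] by (simp add: r_distr)
qed

lemma free_assoc_algebra: "assoc_algebra R (free_algebra R X)"
  by (intro assoc_algebra.intro assoc_algebra_axioms.intro free_ring free_module
      free_smult_left free_smult_right)

end

context assoc_algebra
begin

lemma is_assoc_algebra: "assoc_algebra R M" ..

definition word_prod :: "('x \<Rightarrow> 'a) \<Rightarrow> 'x list \<Rightarrow> 'a"
  where "word_prod \<phi> w = foldr (\<lambda>x a. \<phi> x \<otimes>\<^bsub>M\<^esub> a) w \<one>\<^bsub>M\<^esub>"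

definition free_eval :: "('x \<Rightarrow> 'a) \<Rightarrow> ('x list \<Rightarrow> 'k) \<Rightarrow> 'a"
  where "free_eval \<phi> f = (\<Oplus>\<^bsub>M\<^esub>w\<in>{w. f w \<noteq> \<zero>\<^bsub>R\<^esub>}. f w \<odot>\<^bsub>M\<^esub> word_prod \<phi> w)"

lemma word_prod_closed: "\<phi> ` X \<subseteq> carrier M \<Longrightarrow> set w \<subseteq> X \<Longrightarrow> word_prod \<phi> w \<in> carrier M"
  by (induction w) (auto simp: word_prod_def)

lemma word_prod_append:
  assumes X: "\<phi> ` X \<subseteq> carrier M" and "set u \<subseteq> X" and v: "set v \<subseteq> X"
  shows "word_prod \<phi> (u @ v) = word_prod \<phi> u \<otimes>\<^bsub>M\<^esub> word_prod \<phi> v"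
  using assms(2)
proof (induction u)
  case Nil
  then show ?case using word_prod_closed[OF X v] by (simp add: word_prod_def)
next
  case (Cons x u)
  have "\<phi> x \<in> carrier M" "word_prod \<phi> u \<in> carrier M"
    using Cons.prems X word_prod_closed[OF X, of u] by auto
  then show ?case using Cons word_prod_closed[OF X v] by (simp add: word_prod_def M.m_assoc)
qed

lemma free_eval_superset:
  assumes X: "\<phi> ` X \<subseteq> carrier M" and f: "f \<in> carrier (free_algebra R X)"
    and S: "finite S" "{w. f w \<noteq> \<zero>\<^bsub>R\<^esub>} \<subseteq> S" "S \<subseteq> lists X"
  shows "free_eval \<phi> f = (\<Oplus>\<^bsub>M\<^esub>w\<in>S. f w \<odot>\<^bsub>M\<^esub> word_prod \<phi> w)"
  unfolding free_eval_def
proof (rule M.add.finprod_mono_neutral_cong_left)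
  have wp: "word_prod \<phi> w \<in> carrier M" if "w \<in> S" for w
    using word_prod_closed[OF X, of w] S that by (auto simp: in_lists_conv_set)
  show "(\<lambda>w. f w \<odot>\<^bsub>M\<^esub> word_prod \<phi> w) \<in> S \<rightarrow> carrier M"
    using wp R.free_val[OF f] by auto
  show "f w \<odot>\<^bsub>M\<^esub> word_prod \<phi> w = \<zero>\<^bsub>M\<^esub>" if "w \<in> S - {w. f w \<noteq> \<zero>\<^bsub>R\<^esub>}" for w
    using wp that by simp
qed (use S in auto)

lemma free_eval_closed:
  assumes X: "\<phi> ` X \<subseteq> carrier M" and f: "f \<in> carrier (free_algebra R X)"
  shows "free_eval \<phi> f \<in> carrier M"
  unfolding free_eval_def using f word_prod_closed[OF X]
  by (intro M.finsum_closed) (auto simp: free_algebra_carrier_iff)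

lemma free_eval_zero: "free_eval \<phi> (\<lambda>w. \<zero>\<^bsub>R\<^esub>) = \<zero>\<^bsub>M\<^esub>"
  by (simp add: free_eval_def)

lemma free_eval_mono:
  assumes X: "\<phi> ` X \<subseteq> carrier M" and c: "c \<in> carrier R" and u: "set u \<subseteq> X"
  shows "free_eval \<phi> (free_mono R c u) = c \<odot>\<^bsub>M\<^esub> word_prod \<phi> u"
proof -
  have "free_eval \<phi> (free_mono R c u) = (\<Oplus>\<^bsub>M\<^esub>w\<in>{u}. free_mono R c u w \<odot>\<^bsub>M\<^esub> word_prod \<phi> w)"
    by (rule free_eval_superset[OF X R.free_mono_carrier[OF c u]])
       (use u in \<open>auto simp: free_mono_def\<close>)
  also have "\<dots> = c \<odot>\<^bsub>M\<^esub> word_prod \<phi> u"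
    using c word_prod_closed[OF X u] by (simp add: free_mono_def)
  finally show ?thesis .
qed

lemma free_eval_add:
  assumes X: "\<phi> ` X \<subseteq> carrier M"
    and f: "f \<in> carrier (free_algebra R X)" and g: "g \<in> carrier (free_algebra R X)"
  shows "free_eval \<phi> (\<lambda>w. f w \<oplus>\<^bsub>R\<^esub> g w) = free_eval \<phi> f \<oplus>\<^bsub>M\<^esub> free_eval \<phi> g"
proof -
  define S where "S = {w. f w \<noteq> \<zero>\<^bsub>R\<^esub>} \<union> {w. g w \<noteq> \<zero>\<^bsub>R\<^esub>}"
  have S: "finite S" "S \<subseteq> lists X"
    using f g by (auto simp: S_def free_algebra_carrier_iff)
  have wp: "word_prod \<phi> w \<in> carrier M" if "w \<in> S" for w
    using word_prod_closed[OF X, of w] S that by (auto simp: in_lists_conv_set)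
  have sup: "{w. f w \<oplus>\<^bsub>R\<^esub> g w \<noteq> \<zero>\<^bsub>R\<^esub>} \<subseteq> S" "{w. f w \<noteq> \<zero>\<^bsub>R\<^esub>} \<subseteq> S" "{w. g w \<noteq> \<zero>\<^bsub>R\<^esub>} \<subseteq> S"
    by (auto simp: S_def)
  have "free_eval \<phi> (\<lambda>w. f w \<oplus>\<^bsub>R\<^esub> g w) =
      (\<Oplus>\<^bsub>M\<^esub>w\<in>S. (f w \<oplus>\<^bsub>R\<^esub> g w) \<odot>\<^bsub>M\<^esub> word_prod \<phi> w)"
    by (rule free_eval_superset[OF X R.free_add_closed[OF f g] S(1) sup(1) S(2)])
  also have "\<dots> = (\<Oplus>\<^bsub>M\<^esub>w\<in>S. f w \<odot>\<^bsub>M\<^esub> word_prod \<phi> w \<oplus>\<^bsub>M\<^esub> g w \<odot>\<^bsub>M\<^esub> word_prod \<phi> w)"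
    using wp R.free_val[OF f] R.free_val[OF g]
    by (intro M.add.finprod_cong') (auto simp: smult_l_distr)
  also have "\<dots> = (\<Oplus>\<^bsub>M\<^esub>w\<in>S. f w \<odot>\<^bsub>M\<^esub> word_prod \<phi> w) \<oplus>\<^bsub>M\<^esub> (\<Oplus>\<^bsub>M\<^esub>w\<in>S. g w \<odot>\<^bsub>M\<^esub> word_prod \<phi> w)"
    using wp R.free_val[OF f] R.free_val[OF g] by (intro M.finsum_addf) auto
  also have "\<dots> = free_eval \<phi> f \<oplus>\<^bsub>M\<^esub> free_eval \<phi> g"
    using free_eval_superset[OF X f S(1) sup(2) S(2)] free_eval_superset[OF X g S(1) sup(3) S(2)]
    by simp
  finally show ?thesis .
qed

lemma free_eval_smult:
  assumes X: "\<phi> ` X \<subseteq> carrier M" and f: "f \<in> carrier (free_algebra R X)" and c: "c \<in> carrier R"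
  shows "free_eval \<phi> (\<lambda>w. c \<otimes>\<^bsub>R\<^esub> f w) = c \<odot>\<^bsub>M\<^esub> free_eval \<phi> f"
  using f
proof (induction rule: R.free_induct)
  case zero
  then show ?case using c by (simp add: free_eval_zero)
next
  case (mono d u)
  have "(\<lambda>w. c \<otimes>\<^bsub>R\<^esub> free_mono R d u w) = free_mono R (c \<otimes>\<^bsub>R\<^esub> d) u"
    using c by (auto simp: free_mono_def)
  then show ?case using c mono word_prod_closed[OF X]
    by (simp add: free_eval_mono[OF X] smult_assoc1)
next
  case (add f g)
  have "(\<lambda>w. c \<otimes>\<^bsub>R\<^esub> (f w \<oplus>\<^bsub>R\<^esub> g w)) = (\<lambda>w. c \<otimes>\<^bsub>R\<^esub> f w \<oplus>\<^bsub>R\<^esub> c \<otimes>\<^bsub>R\<^esub> g w)"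
    using c R.free_val[OF add(1)] R.free_val[OF add(2)] by (simp add: R.r_distr)
  then show ?case using add c free_eval_closed[OF X]
    by (simp add: free_eval_add[OF X] R.free_smult_closed smult_r_distr)
qed

lemma free_eval_mult:
  assumes X: "\<phi> ` X \<subseteq> carrier M"
    and f: "f \<in> carrier (free_algebra R X)" and g: "g \<in> carrier (free_algebra R X)"
  shows "free_eval \<phi> (f \<otimes>\<^bsub>free_algebra R X\<^esub> g) = free_eval \<phi> f \<otimes>\<^bsub>M\<^esub> free_eval \<phi> g"
  using f
proof (induction rule: R.free_induct)
  case zero
  then show ?case using free_eval_closed[OF X g] by (simp only: R.free_null g free_eval_zero M.l_null)
next
  case (add f1 f2)
  then show ?case using free_eval_closed[OF X]
    by (simp only: R.free_l_distr R.free_m_closed free_eval_add[OF X] g M.l_distr)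
next
  case (mono c u)
  note cu = mono and mc = R.free_mono_carrier[OF mono]
  show ?case using g
  proof (induction rule: R.free_induct)
    case zero
    then show ?case using free_eval_closed[OF X mc]
      by (simp only: R.free_null mc free_eval_zero M.r_null)
  next
    case (add g1 g2)
    then show ?case using free_eval_closed[OF X]
      by (simp only: R.free_r_distr R.free_m_closed free_eval_add[OF X] mc M.r_distr)
  next
    case (mono d v)
    have "set (u @ v) \<subseteq> X" using cu mono by simp
    then have "free_eval \<phi> (free_mono R c u \<otimes>\<^bsub>free_algebra R X\<^esub> free_mono R d v) =
        (c \<otimes>\<^bsub>R\<^esub> d) \<odot>\<^bsub>M\<^esub> word_prod \<phi> (u @ v)"
      using cu mono by (simp only: R.free_mono_mult free_eval_mono[OF X] R.m_closed)
    also have "\<dots> = (c \<odot>\<^bsub>M\<^esub> word_prod \<phi> u) \<otimes>\<^bsub>M\<^esub> (d \<odot>\<^bsub>M\<^esub> word_prod \<phi> v)"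
      using cu mono word_prod_closed[OF X]
      by (simp add: word_prod_append[OF X] smult_assoc1 smult_assoc_left smult_assoc_right
          del: smult_assoc1) (simp flip: smult_assoc1 add: R.m_comm)
    finally show ?case using cu mono by (simp only: free_eval_mono[OF X])
  qed
qed

lemma free_eval_var:
  assumes X: "\<phi> ` X \<subseteq> carrier M" and x: "x \<in> X"
  shows "free_eval \<phi> (free_var R x) = \<phi> x"
proof -
  have "free_var R x = free_mono R \<one>\<^bsub>R\<^esub> [x]" by (auto simp: free_var_def free_mono_def)
  then show ?thesis using assms
    by (simp add: free_eval_mono[OF X] word_prod_def image_subset_iff)
qed

lemma free_eval_hom:
  assumes X: "\<phi> ` X \<subseteq> carrier M"
  shows "free_eval \<phi> \<in> alg_hom R (free_algebra R X) M"
proof -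
  have "free_eval \<phi> \<in> ring_hom (free_algebra R X) M"
  proof (rule ring_hom_memI)
    show "free_eval \<phi> \<one>\<^bsub>free_algebra R X\<^esub> = \<one>\<^bsub>M\<^esub>"
      unfolding R.free_one_mono by (simp add: free_eval_mono[OF X] word_prod_def)
    fix f g assume fg: "f \<in> carrier (free_algebra R X)" "g \<in> carrier (free_algebra R X)"
    show "free_eval \<phi> (f \<otimes>\<^bsub>free_algebra R X\<^esub> g) = free_eval \<phi> f \<otimes>\<^bsub>M\<^esub> free_eval \<phi> g"
      by (rule free_eval_mult[OF X fg])
    show "free_eval \<phi> (f \<oplus>\<^bsub>free_algebra R X\<^esub> g) = free_eval \<phi> f \<oplus>\<^bsub>M\<^esub> free_eval \<phi> g"
      using free_eval_add[OF X fg] by simp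
  qed (rule free_eval_closed[OF X])
  then show ?thesis using free_eval_smult[OF X] by (simp add: alg_hom_def)
qed

end

lemma alg_homD:
  assumes "h \<in> alg_hom K A B"
  shows "x \<in> carrier A \<Longrightarrow> h x \<in> carrier B"
    and "x \<in> carrier A \<Longrightarrow> y \<in> carrier A \<Longrightarrow> h (x \<oplus>\<^bsub>A\<^esub> y) = h x \<oplus>\<^bsub>B\<^esub> h y"
    and "x \<in> carrier A \<Longrightarrow> y \<in> carrier A \<Longrightarrow> h (x \<otimes>\<^bsub>A\<^esub> y) = h x \<otimes>\<^bsub>B\<^esub> h y"
    and "h \<one>\<^bsub>A\<^esub> = \<one>\<^bsub>B\<^esub>"
    and "c \<in> carrier K \<Longrightarrow> x \<in> carrier A \<Longrightarrow> h (c \<odot>\<^bsub>A\<^esub> x) = c \<odot>\<^bsub>B\<^esub> h x"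
  using assms by (auto simp: alg_hom_def ring_hom_def)

lemma alg_homI:
  assumes "\<And>x. x \<in> carrier A \<Longrightarrow> h x \<in> carrier B"
    and "\<And>x y. x \<in> carrier A \<Longrightarrow> y \<in> carrier A \<Longrightarrow> h (x \<oplus>\<^bsub>A\<^esub> y) = h x \<oplus>\<^bsub>B\<^esub> h y"
    and "\<And>x y. x \<in> carrier A \<Longrightarrow> y \<in> carrier A \<Longrightarrow> h (x \<otimes>\<^bsub>A\<^esub> y) = h x \<otimes>\<^bsub>B\<^esub> h y"
    and "h \<one>\<^bsub>A\<^esub> = \<one>\<^bsub>B\<^esub>"
    and "\<And>c x. c \<in> carrier K \<Longrightarrow> x \<in> carrier A \<Longrightarrow> h (c \<odot>\<^bsub>A\<^esub> x) = c \<odot>\<^bsub>B\<^esub> h x"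
  shows "h \<in> alg_hom K A B"
  using assms by (auto simp: alg_hom_def ring_hom_def)

lemma alg_hom_zero:
  assumes "assoc_algebra K A" "assoc_algebra K B" "h \<in> alg_hom K A B"
  shows "h \<zero>\<^bsub>A\<^esub> = \<zero>\<^bsub>B\<^esub>"
proof -
  interpret A: assoc_algebra K A by fact
  interpret B: assoc_algebra K B by fact
  have "h \<zero>\<^bsub>A\<^esub> = h (\<zero>\<^bsub>K\<^esub> \<odot>\<^bsub>A\<^esub> \<zero>\<^bsub>A\<^esub>)" by simp
  also have "\<dots> = \<zero>\<^bsub>K\<^esub> \<odot>\<^bsub>B\<^esub> h \<zero>\<^bsub>A\<^esub>" by (rule alg_homD(5)[OF assms(3)]) simp_all
  also have "\<dots> = \<zero>\<^bsub>B\<^esub>" by (intro B.smult_l_null alg_homD(1)[OF assms(3)]) simp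
  finally show ?thesis .
qed

lemma free_var_carrier:
  assumes "cring K" "x \<in> X"
  shows "free_var K x \<in> carrier (free_algebra K X)"
proof -
  interpret cring K by fact
  have "free_var K x = free_mono K \<one>\<^bsub>K\<^esub> [x]" by (auto simp: free_var_def free_mono_def)
  then show ?thesis using assms(2) by (simp add: free_mono_carrier)
qed

lemma free_algebra_hom_unique:
  assumes "assoc_algebra K C"
    and g: "g \<in> alg_hom K (free_algebra K X) C" and h: "h \<in> alg_hom K (free_algebra K X) C"
    and eq: "\<And>x. x \<in> X \<Longrightarrow> g (free_var K x) = h (free_var K x)"
    and f: "f \<in> carrier (free_algebra K X)"
  shows "g f = h f"
proof -
  interpret C: assoc_algebra K C by fact
  note FA = C.R.free_assoc_algebra[where X = X]
  have word: "g (free_mono K \<one>\<^bsub>K\<^esub> u) = h (free_mono K \<one>\<^bsub>K\<^esub> u)" if "set u \<subseteq> X" for u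
    using that
  proof (induction u)
    case Nil
    have "free_mono K \<one>\<^bsub>K\<^esub> [] = \<one>\<^bsub>free_algebra K X\<^esub>"
      by (simp add: C.R.free_one_mono del: free_algebra_simps)
    then show ?case using alg_homD(4)[OF g] alg_homD(4)[OF h] by (simp del: free_algebra_simps)
  next
    case (Cons x u)
    have v: "free_var K x = free_mono K \<one>\<^bsub>K\<^esub> [x]" by (auto simp: free_var_def free_mono_def)
    have x: "free_var K x \<in> carrier (free_algebra K X)"
      using Cons.prems by (intro free_var_carrier C.R.is_cring) auto
    have u: "free_mono K \<one>\<^bsub>K\<^esub> u \<in> carrier (free_algebra K X)"
      using Cons.prems by (intro C.R.free_mono_carrier) auto
    have "free_mono K \<one>\<^bsub>K\<^esub> (x # u) = free_var K x \<otimes>\<^bsub>free_algebra K X\<^esub> free_mono K \<one>\<^bsub>K\<^esub> u"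
      unfolding v by (subst C.R.free_mono_mult) auto
    then show ?case
      using alg_homD(3)[OF g x u] alg_homD(3)[OF h x u] Cons eq[of x] by (simp del: free_algebra_simps)
  qed
  show ?thesis using f
  proof (induction rule: C.R.free_induct)
    case zero
    then show ?case
      using alg_hom_zero[OF FA assms(1) g] alg_hom_zero[OF FA assms(1) h] by simp
  next
    case (mono c u)
    have "free_mono K c u = c \<odot>\<^bsub>free_algebra K X\<^esub> free_mono K \<one>\<^bsub>K\<^esub> u"
      using mono by (auto simp: free_mono_def)
    moreover have "free_mono K \<one>\<^bsub>K\<^esub> u \<in> carrier (free_algebra K X)"
      using mono by (intro C.R.free_mono_carrier) auto
    ultimately show ?case
      using alg_homD(5)[OF g] alg_homD(5)[OF h] mono word by (simp del: free_algebra_simps)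
  next
    case (add f1 f2)
    then show ?case using alg_homD(2)[OF g, of f1 f2] alg_homD(2)[OF h, of f1 f2] by simp
  qed
qed

theorem free_algebra_universal:
  assumes "assoc_algebra K C" "\<phi> ` X \<subseteq> carrier C"
  shows "\<exists>h\<in>alg_hom K (free_algebra K X) C. (\<forall>x\<in>X. h (free_var K x) = \<phi> x) \<and>
    (\<forall>h'\<in>alg_hom K (free_algebra K X) C. (\<forall>x\<in>X. h' (free_var K x) = \<phi> x) \<longrightarrow>
      (\<forall>f\<in>carrier (free_algebra K X). h' f = h f))"
proof -
  interpret C: assoc_algebra K C by fact
  have hom: "C.free_eval \<phi> \<in> alg_hom K (free_algebra K X) C"
    by (rule C.free_eval_hom[OF assms(2)])
  have var: "C.free_eval \<phi> (free_var K x) = \<phi> x" if "x \<in> X" for x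
    by (rule C.free_eval_var[OF assms(2) that])
  have "h' f = C.free_eval \<phi> f"
    if "h' \<in> alg_hom K (free_algebra K X) C" "\<forall>x\<in>X. h' (free_var K x) = \<phi> x"
      "f \<in> carrier (free_algebra K X)" for h' f
  proof (rule free_algebra_hom_unique[OF assms(1) that(1) hom _ that(3)])
    show "h' (free_var K x) = C.free_eval \<phi> (free_var K x)" if "x \<in> X" for x
      using that \<open>\<forall>x\<in>X. h' (free_var K x) = \<phi> x\<close> var by simp
  qed
  with hom var show ?thesis by blast
qed

text \<open>The library's univariate polynomials are the free algebra on one generator.\<close>

theorem polynomials_free:
  assumes "cring K"
  shows "alg_isomorphic K (free_algebra K (UNIV :: unit set)) (UP K)"
proof -
  interpret cring K by fact
  define h :: "(unit list \<Rightarrow> 'a) \<Rightarrow> nat \<Rightarrow> 'a" where "h f = (\<lambda>n. f (replicate n ()))" for f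
  let ?F = "free_algebra K (UNIV :: unit set)"
  have word: "replicate (length w) () = w" for w :: "unit list"
    by (metis old.unit.exhaust replicate_eqI)
  have up_iff: "p \<in> up K \<longleftrightarrow> range p \<subseteq> carrier K \<and> finite {n. p n \<noteq> \<zero>\<^bsub>K\<^esub>}" for p
  proof -
    have "(\<exists>n. bound \<zero>\<^bsub>K\<^esub> n p) \<longleftrightarrow> finite {n. p n \<noteq> \<zero>\<^bsub>K\<^esub>}"
      unfolding finite_nat_set_iff_bounded_le bound_def Ball_def mem_Collect_eq
      by (metis linorder_not_less)
    then show ?thesis by (auto simp: up_def)
  qed
  have closed: "h f \<in> up K" if "f \<in> carrier ?F" for f
  proof -
    have "{n. h f n \<noteq> \<zero>\<^bsub>K\<^esub>} \<subseteq> length ` {w. f w \<noteq> \<zero>\<^bsub>K\<^esub>}"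
      by (force simp: h_def)
    then show ?thesis using that
      by (auto simp: up_iff free_algebra_carrier_iff h_def intro: finite_surj)
  qed
  have "h \<in> alg_hom K ?F (UP K)"
  proof (rule alg_homI)
    show "h f \<in> carrier (UP K)" if "f \<in> carrier ?F" for f
      using closed[OF that] by (simp add: UP_def)
    show "h (f \<oplus>\<^bsub>?F\<^esub> g) = h f \<oplus>\<^bsub>UP K\<^esub> h g" if "f \<in> carrier ?F" "g \<in> carrier ?F" for f g
      using that[THEN closed] by (simp add: UP_def) (simp add: h_def)
    show "h (f \<otimes>\<^bsub>?F\<^esub> g) = h f \<otimes>\<^bsub>UP K\<^esub> h g" if "f \<in> carrier ?F" "g \<in> carrier ?F" for f g
    proof
      fix n
      have "h (f \<otimes>\<^bsub>?F\<^esub> g) n =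
          (\<Oplus>\<^bsub>K\<^esub>i\<in>{..n}. f (take i (replicate n ())) \<otimes>\<^bsub>K\<^esub> g (drop i (replicate n ())))"
        by (simp add: h_def)
      also have "\<dots> = (\<Oplus>\<^bsub>K\<^esub>i\<in>{..n}. h f i \<otimes>\<^bsub>K\<^esub> h g (n - i))"
        using free_val[OF that(1)] free_val[OF that(2)]
        by (intro add.finprod_cong') (auto simp: h_def min_def)
      also have "\<dots> = (h f \<otimes>\<^bsub>UP K\<^esub> h g) n"
        using that[THEN closed] by (simp add: UP_def)
      finally show "h (f \<otimes>\<^bsub>?F\<^esub> g) n = (h f \<otimes>\<^bsub>UP K\<^esub> h g) n" .
    qed
    show "h \<one>\<^bsub>?F\<^esub> = \<one>\<^bsub>UP K\<^esub>" by (auto simp: h_def UP_def)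
    show "h (c \<odot>\<^bsub>?F\<^esub> f) = c \<odot>\<^bsub>UP K\<^esub> h f" if "c \<in> carrier K" "f \<in> carrier ?F" for c f
      using that(1) closed[OF that(2)] by (simp add: UP_def) (simp add: h_def)
  qed
  moreover have "bij_betw h (carrier ?F) (carrier (UP K))"
  proof (rule bij_betwI[where g = "\<lambda>p w. p (length w)"])
    show "h \<in> carrier ?F \<rightarrow> carrier (UP K)" using closed by (auto simp: UP_def)
    have "(\<lambda>w :: unit list. p (length w)) \<in> carrier ?F" if "p \<in> up K" for p
    proof -
      have "{w :: unit list. p (length w) \<noteq> \<zero>\<^bsub>K\<^esub>} \<subseteq> (\<lambda>n. replicate n ()) ` {n. p n \<noteq> \<zero>\<^bsub>K\<^esub>}"
        using word by (auto simp: image_iff) metis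
      then show ?thesis using that
        by (auto simp: up_iff free_algebra_carrier_iff intro: finite_surj)
    qed
    then show "(\<lambda>p w. p (length w)) \<in> carrier (UP K) \<rightarrow> carrier ?F" by (auto simp: UP_def)
    show "(\<lambda>w. h f (length w)) = f" for f by (simp add: h_def word)
    show "h (\<lambda>w. p (length w)) = p" for p by (simp add: h_def)
  qed
  ultimately show ?thesis by (auto simp: alg_isomorphic_def)
qed

section \<open>Free products are coproducts\<close>

lemma quotient_algebra_simps:
  "carrier (quotient_algebra A I) = carrier (A Quot I)"
  "mult (quotient_algebra A I) = mult (A Quot I)"
  "one (quotient_algebra A I) = one (A Quot I)"
  "zero (quotient_algebra A I) = zero (A Quot I)"
  "add (quotient_algebra A I) = add (A Quot I)"
  "smult (quotient_algebra A I) = (\<lambda>c X. \<Union>x\<in>X. I +>\<^bsub>A\<^esub> (c \<odot>\<^bsub>A\<^esub> x))"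
  by (simp_all add: quotient_algebra_def ring.defs module.defs)

locale quotient_setup = assoc_algebra K A + I?: ideal I A
  for K :: "('k, 'm) ring_scheme" and A :: "('k, 'a, 'n) module_scheme" and I :: "'a set"
begin

abbreviation Q where "Q \<equiv> quotient_algebra A I"
abbreviation cls where "cls a \<equiv> I +>\<^bsub>A\<^esub> a"

lemma cls_ops:
  assumes "x \<in> carrier A" "y \<in> carrier A"
  shows "cls x \<oplus>\<^bsub>Q\<^esub> cls y = cls (x \<oplus>\<^bsub>A\<^esub> y)" "cls x \<otimes>\<^bsub>Q\<^esub> cls y = cls (x \<otimes>\<^bsub>A\<^esub> y)"
  using assms by (simp_all add: quotient_algebra_simps FactRing_def a_rcos_sum rcoset_mult_add)

lemma cls_one: "\<one>\<^bsub>Q\<^esub> = cls \<one>\<^bsub>A\<^esub>"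
  by (simp add: quotient_algebra_simps FactRing_def)

lemma cls_carrier: "x \<in> carrier A \<Longrightarrow> cls x \<in> carrier Q"
  by (auto simp: quotient_algebra_simps FactRing_simps)

lemma carrier_cls: "X \<in> carrier Q \<Longrightarrow> \<exists>x\<in>carrier A. X = cls x"
  by (auto simp: quotient_algebra_simps FactRing_simps)

lemma smult_ideal:
  assumes "c \<in> carrier K" "i \<in> I"
  shows "c \<odot>\<^bsub>A\<^esub> i \<in> I"
proof -
  have i: "i \<in> carrier A" using assms(2) by (rule a_Hcarr)
  have "(c \<odot>\<^bsub>A\<^esub> \<one>\<^bsub>A\<^esub>) \<otimes>\<^bsub>A\<^esub> i \<in> I" using assms by (intro I_l_closed) auto
  then show ?thesis using smult_assoc_left[OF assms(1) _ i, of "\<one>\<^bsub>A\<^esub>"] i by simp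
qed

lemma cls_smult:
  assumes c: "c \<in> carrier K" and a: "a \<in> carrier A"
  shows "c \<odot>\<^bsub>Q\<^esub> cls a = cls (c \<odot>\<^bsub>A\<^esub> a)"
proof -
  have "cls (c \<odot>\<^bsub>A\<^esub> x) = cls (c \<odot>\<^bsub>A\<^esub> a)" if x: "x \<in> cls a" for x
  proof -
    obtain i where i: "i \<in> I" "x = i \<oplus>\<^bsub>A\<^esub> a" using x by (auto simp: a_r_coset_def')
    then have "c \<odot>\<^bsub>A\<^esub> x = c \<odot>\<^bsub>A\<^esub> i \<oplus>\<^bsub>A\<^esub> c \<odot>\<^bsub>A\<^esub> a"
      using c a a_Hcarr by (simp add: smult_r_distr)
    then have "c \<odot>\<^bsub>A\<^esub> x \<in> cls (c \<odot>\<^bsub>A\<^esub> a)"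
      using smult_ideal[OF c i(1)] by (auto simp: a_r_coset_def')
    then show ?thesis using c a by (intro a_repr_independence[symmetric] a_subgroup) auto
  qed
  moreover have "a \<in> cls a" using a by (rule a_rcos_self)
  ultimately have "(\<Union>x\<in>cls a. cls (c \<odot>\<^bsub>A\<^esub> x)) = cls (c \<odot>\<^bsub>A\<^esub> a)" by blast
  then show ?thesis by (simp only: quotient_algebra_simps)
qed

lemma quotient_ring: "ring Q"
proof -
  interpret Q: ring "A Quot I" by (rule quotient_is_ring)
  show ?thesis
  proof (rule ringI)
    show "abelian_group Q"
    proof (rule abelian_groupI)
      fix X assume "X \<in> carrier Q"
      then show "\<exists>Y\<in>carrier Q. Y \<oplus>\<^bsub>Q\<^esub> X = \<zero>\<^bsub>Q\<^esub>"
        using Q.add.l_inv_ex by (simp add: quotient_algebra_simps)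
    qed (simp_all add: quotient_algebra_simps Q.a_assoc, simp add: Q.a_comm)
    show "Group.monoid Q"
      by (rule monoidI) (auto simp: quotient_algebra_simps Q.m_assoc)
  qed (auto simp: quotient_algebra_simps Q.l_distr Q.r_distr)
qed

lemma quotient_module: "module K Q"
proof (rule moduleI)
  show "cring K" by (rule R.is_cring)
  show "abelian_group Q" by (rule ring.is_abelian_group[OF quotient_ring])
next
  fix c d X assume c: "c \<in> carrier K" "d \<in> carrier K" and "X \<in> carrier Q"
  then obtain x where x: "x \<in> carrier A" "X = cls x" using carrier_cls by blast
  show "(c \<oplus>\<^bsub>K\<^esub> d) \<odot>\<^bsub>Q\<^esub> X = c \<odot>\<^bsub>Q\<^esub> X \<oplus>\<^bsub>Q\<^esub> d \<odot>\<^bsub>Q\<^esub> X"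
    using c x by (simp add: cls_smult cls_ops smult_l_distr)
  show "(c \<otimes>\<^bsub>K\<^esub> d) \<odot>\<^bsub>Q\<^esub> X = c \<odot>\<^bsub>Q\<^esub> (d \<odot>\<^bsub>Q\<^esub> X)"
    using c x by (simp add: cls_smult smult_assoc1)
next
  fix c X Y assume c: "c \<in> carrier K" and "X \<in> carrier Q" "Y \<in> carrier Q"
  then obtain x y where x: "x \<in> carrier A" "X = cls x" "y \<in> carrier A" "Y = cls y"
    using carrier_cls by blast
  show "c \<odot>\<^bsub>Q\<^esub> (X \<oplus>\<^bsub>Q\<^esub> Y) = c \<odot>\<^bsub>Q\<^esub> X \<oplus>\<^bsub>Q\<^esub> c \<odot>\<^bsub>Q\<^esub> Y"
    using c x by (simp add: cls_smult cls_ops smult_r_distr)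
next
  fix c X assume c: "c \<in> carrier K" and "X \<in> carrier Q"
  then obtain x where x: "x \<in> carrier A" "X = cls x" using carrier_cls by blast
  show "c \<odot>\<^bsub>Q\<^esub> X \<in> carrier Q" using c x by (simp add: cls_smult cls_carrier)
next
  fix X assume "X \<in> carrier Q"
  then obtain x where x: "x \<in> carrier A" "X = cls x" using carrier_cls by blast
  then show "\<one>\<^bsub>K\<^esub> \<odot>\<^bsub>Q\<^esub> X = X" by (simp add: cls_smult)
qed

lemma quotient_assoc_algebra: "assoc_algebra K Q"
proof (intro assoc_algebra.intro assoc_algebra_axioms.intro quotient_ring quotient_module)
  fix c X Y assume c: "c \<in> carrier K" and "X \<in> carrier Q" "Y \<in> carrier Q"
  then obtain x y where x: "x \<in> carrier A" "X = cls x" "y \<in> carrier A" "Y = cls y"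
    using carrier_cls by blast
  show "(c \<odot>\<^bsub>Q\<^esub> X) \<otimes>\<^bsub>Q\<^esub> Y = c \<odot>\<^bsub>Q\<^esub> (X \<otimes>\<^bsub>Q\<^esub> Y)"
    using c x by (simp add: cls_smult cls_ops smult_assoc_left)
  show "X \<otimes>\<^bsub>Q\<^esub> (c \<odot>\<^bsub>Q\<^esub> Y) = c \<odot>\<^bsub>Q\<^esub> (X \<otimes>\<^bsub>Q\<^esub> Y)"
    using c x by (simp add: cls_smult cls_ops smult_assoc_right)
qed

lemma cls_hom: "cls \<in> alg_hom K A Q"
  by (rule alg_homI) (auto simp: cls_carrier cls_ops cls_one cls_smult)

lemma cls_eq_zero: "i \<in> I \<Longrightarrow> cls i = \<zero>\<^bsub>Q\<^esub>"
  using a_rcos_const by (simp add: quotient_algebra_simps FactRing_def)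

lemma cls_eqI:
  assumes "x \<in> carrier A" "y \<in> carrier A" "x \<ominus>\<^bsub>A\<^esub> y \<in> I"
  shows "cls x = cls y"
  using assms by (metis quotient_eq_iff_same_a_r_cos is_ideal)

lemma descend:
  assumes C: "assoc_algebra K C" and h: "h \<in> alg_hom K A C"
    and ker: "\<And>i. i \<in> I \<Longrightarrow> h i = \<zero>\<^bsub>C\<^esub>"
  shows "\<exists>g\<in>alg_hom K Q C. \<forall>a\<in>carrier A. g (cls a) = h a"
proof -
  interpret C: assoc_algebra K C by fact
  define g where "g X = h (SOME x. x \<in> X)" for X
  have g: "g (cls a) = h a" if a: "a \<in> carrier A" for a
  proof -
    have "(SOME x. x \<in> cls a) \<in> cls a" using a_rcos_self[OF a] by (rule someI)
    then obtain i where i: "i \<in> I" "(SOME x. x \<in> cls a) = i \<oplus>\<^bsub>A\<^esub> a"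
      by (auto simp: a_r_coset_def')
    then have "g (cls a) = \<zero>\<^bsub>C\<^esub> \<oplus>\<^bsub>C\<^esub> h a"
      using alg_homD(2)[OF h, of i a] a a_Hcarr ker by (simp add: g_def)
    then show ?thesis using alg_homD(1)[OF h a] by simp
  qed
  have "g \<in> alg_hom K Q C"
  proof (rule alg_homI)
    fix X Y assume "X \<in> carrier Q" "Y \<in> carrier Q"
    then obtain x y where x: "x \<in> carrier A" "X = cls x" "y \<in> carrier A" "Y = cls y"
      using carrier_cls by blast
    show "g (X \<oplus>\<^bsub>Q\<^esub> Y) = g X \<oplus>\<^bsub>C\<^esub> g Y" "g (X \<otimes>\<^bsub>Q\<^esub> Y) = g X \<otimes>\<^bsub>C\<^esub> g Y"
      using x by (simp_all add: g cls_ops alg_homD(2,3)[OF h])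
  next
    fix X assume "X \<in> carrier Q"
    then obtain x where x: "x \<in> carrier A" "X = cls x" using carrier_cls by blast
    then show "g X \<in> carrier C" by (simp add: g alg_homD(1)[OF h])
    show "g (c \<odot>\<^bsub>Q\<^esub> X) = c \<odot>\<^bsub>C\<^esub> g X" if "c \<in> carrier K" for c
      using x that by (simp add: g cls_smult alg_homD(5)[OF h])
  next
    show "g \<one>\<^bsub>Q\<^esub> = \<one>\<^bsub>C\<^esub>" by (simp add: g cls_one alg_homD(4)[OF h])
  qed
  with g show ?thesis by blast
qed

end

lemma free_product_setup:
  assumes "assoc_algebra K A" "assoc_algebra K B"
  shows "quotient_setup K (free_product_generators K A B) (free_product_ideal K A B)"
    and "hom_relations K A (free_product_generators K A B) (\<lambda>a. free_var K (Inl a)) \<subseteq>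
      free_product_ideal K A B"
    and "hom_relations K B (free_product_generators K A B) (\<lambda>b. free_var K (Inr b)) \<subseteq>
      free_product_ideal K A B"
proof -
  interpret A: assoc_algebra K A by fact
  interpret B: assoc_algebra K B by fact
  let ?F = "free_product_generators K A B"
  interpret F: assoc_algebra K ?F by (rule A.R.free_assoc_algebra)
  have v: "free_var K (Inl a) \<in> carrier ?F" if "a \<in> carrier A" for a
    using that by (intro free_var_carrier A.R.is_cring) auto
  have w: "free_var K (Inr b) \<in> carrier ?F" if "b \<in> carrier B" for b
    using that by (intro free_var_carrier A.R.is_cring) auto
  have sub: "hom_relations K A ?F (\<lambda>a. free_var K (Inl a)) \<union>
      hom_relations K B ?F (\<lambda>b. free_var K (Inr b)) \<subseteq> carrier ?F"
    unfolding hom_relations_def using v w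
    by (auto simp del: free_algebra_simps intro!: F.M.minus_closed)
  have "ideal (free_product_ideal K A B) ?F"
    unfolding free_product_ideal_def by (rule F.M.genideal_ideal[OF sub])
  then show "quotient_setup K ?F (free_product_ideal K A B)"
    by (intro quotient_setup.intro F.is_assoc_algebra)
  show "hom_relations K A ?F (\<lambda>a. free_var K (Inl a)) \<subseteq> free_product_ideal K A B"
    and "hom_relations K B ?F (\<lambda>b. free_var K (Inr b)) \<subseteq> free_product_ideal K A B"
    using F.M.genideal_self[OF sub] by (auto simp: free_product_ideal_def)
qed

theorem free_product_assoc_algebra:
  assumes "assoc_algebra K A" "assoc_algebra K B"
  shows "assoc_algebra K (free_product K A B)"
  unfolding free_product_def
  by (rule quotient_setup.quotient_assoc_algebra[OF free_product_setup(1)[OF assms]])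

lemma hom_relations_add:
  "x \<in> carrier A \<Longrightarrow> y \<in> carrier A \<Longrightarrow>
    \<iota> (x \<oplus>\<^bsub>A\<^esub> y) \<ominus>\<^bsub>F\<^esub> (\<iota> x \<oplus>\<^bsub>F\<^esub> \<iota> y) \<in> hom_relations K A F \<iota>"
  unfolding hom_relations_def
  by (rule UnI1, rule UnI1, rule UnI1, rule CollectI, rule exI, rule exI, rule conjI, rule refl, rule conjI)

lemma hom_relations_smult:
  "c \<in> carrier K \<Longrightarrow> x \<in> carrier A \<Longrightarrow>
    \<iota> (c \<odot>\<^bsub>A\<^esub> x) \<ominus>\<^bsub>F\<^esub> (c \<odot>\<^bsub>F\<^esub> \<iota> x) \<in> hom_relations K A F \<iota>"
  unfolding hom_relations_def
  by (rule UnI1, rule UnI1, rule UnI2, rule CollectI, rule exI, rule exI, rule conjI, rule refl, rule conjI)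

lemma hom_relations_mult:
  "x \<in> carrier A \<Longrightarrow> y \<in> carrier A \<Longrightarrow>
    \<iota> (x \<otimes>\<^bsub>A\<^esub> y) \<ominus>\<^bsub>F\<^esub> (\<iota> x \<otimes>\<^bsub>F\<^esub> \<iota> y) \<in> hom_relations K A F \<iota>"
  unfolding hom_relations_def
  by (rule UnI1, rule UnI2, rule CollectI, rule exI, rule exI, rule conjI, rule refl, rule conjI)

lemma hom_relations_one:
  "\<iota> \<one>\<^bsub>A\<^esub> \<ominus>\<^bsub>F\<^esub> \<one>\<^bsub>F\<^esub> \<in> hom_relations K A F \<iota>"
  unfolding hom_relations_def by (rule UnI2, rule singletonI)

lemma hom_relations_quotient:
  assumes Q: "quotient_setup K F I" and A: "assoc_algebra K A"
    and \<iota>: "\<iota> ` carrier A \<subseteq> carrier F" and rel: "hom_relations K A F \<iota> \<subseteq> I"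
  shows "(\<lambda>a. I +>\<^bsub>F\<^esub> \<iota> a) \<in> alg_hom K A (quotient_algebra F I)"
proof -
  interpret Q: quotient_setup K F I by fact
  interpret A: assoc_algebra K A by fact
  have c: "\<iota> a \<in> carrier F" if "a \<in> carrier A" for a using \<iota> that by auto
  have add: "Q.cls (\<iota> (x \<oplus>\<^bsub>A\<^esub> y)) = Q.cls (\<iota> x) \<oplus>\<^bsub>Q.Q\<^esub> Q.cls (\<iota> y)"
    if xy: "x \<in> carrier A" "y \<in> carrier A" for x y
  proof -
    have "\<iota> (x \<oplus>\<^bsub>A\<^esub> y) \<ominus>\<^bsub>F\<^esub> (\<iota> x \<oplus>\<^bsub>F\<^esub> \<iota> y) \<in> I"
      by (rule subsetD[OF rel hom_relations_add[OF xy]])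
    then have "Q.cls (\<iota> (x \<oplus>\<^bsub>A\<^esub> y)) = Q.cls (\<iota> x \<oplus>\<^bsub>F\<^esub> \<iota> y)"
      by (intro Q.cls_eqI c xy Q.M.add.m_closed A.M.add.m_closed)
    also have "\<dots> = Q.cls (\<iota> x) \<oplus>\<^bsub>Q.Q\<^esub> Q.cls (\<iota> y)"
      by (rule Q.cls_ops(1)[OF c[OF xy(1)] c[OF xy(2)], symmetric])
    finally show ?thesis .
  qed
  have mult: "Q.cls (\<iota> (x \<otimes>\<^bsub>A\<^esub> y)) = Q.cls (\<iota> x) \<otimes>\<^bsub>Q.Q\<^esub> Q.cls (\<iota> y)"
    if xy: "x \<in> carrier A" "y \<in> carrier A" for x y
  proof -
    have "\<iota> (x \<otimes>\<^bsub>A\<^esub> y) \<ominus>\<^bsub>F\<^esub> (\<iota> x \<otimes>\<^bsub>F\<^esub> \<iota> y) \<in> I"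
      by (rule subsetD[OF rel hom_relations_mult[OF xy]])
    then have "Q.cls (\<iota> (x \<otimes>\<^bsub>A\<^esub> y)) = Q.cls (\<iota> x \<otimes>\<^bsub>F\<^esub> \<iota> y)"
      by (intro Q.cls_eqI c xy Q.M.m_closed A.M.m_closed)
    also have "\<dots> = Q.cls (\<iota> x) \<otimes>\<^bsub>Q.Q\<^esub> Q.cls (\<iota> y)"
      by (rule Q.cls_ops(2)[OF c[OF xy(1)] c[OF xy(2)], symmetric])
    finally show ?thesis .
  qed
  have smult: "Q.cls (\<iota> (k \<odot>\<^bsub>A\<^esub> x)) = k \<odot>\<^bsub>Q.Q\<^esub> Q.cls (\<iota> x)"
    if kx: "k \<in> carrier K" "x \<in> carrier A" for k x
  proof -
    have "\<iota> (k \<odot>\<^bsub>A\<^esub> x) \<ominus>\<^bsub>F\<^esub> (k \<odot>\<^bsub>F\<^esub> \<iota> x) \<in> I"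
      by (rule subsetD[OF rel hom_relations_smult[OF kx]])
    then have "Q.cls (\<iota> (k \<odot>\<^bsub>A\<^esub> x)) = Q.cls (k \<odot>\<^bsub>F\<^esub> \<iota> x)"
      by (intro Q.cls_eqI c kx Q.smult_closed A.smult_closed)
    also have "\<dots> = k \<odot>\<^bsub>Q.Q\<^esub> Q.cls (\<iota> x)"
      by (rule Q.cls_smult[OF kx(1) c[OF kx(2)], symmetric])
    finally show ?thesis .
  qed
  have one: "Q.cls (\<iota> \<one>\<^bsub>A\<^esub>) = \<one>\<^bsub>Q.Q\<^esub>"
  proof -
    have "\<iota> \<one>\<^bsub>A\<^esub> \<ominus>\<^bsub>F\<^esub> \<one>\<^bsub>F\<^esub> \<in> I"
      by (rule subsetD[OF rel hom_relations_one])
    then have "Q.cls (\<iota> \<one>\<^bsub>A\<^esub>) = Q.cls \<one>\<^bsub>F\<^esub>"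
      by (intro Q.cls_eqI c Q.M.one_closed A.M.one_closed)
    then show ?thesis by (simp only: Q.cls_one)
  qed
  show ?thesis
    by (rule alg_homI[OF Q.cls_carrier[OF c] add mult one smult])
qed

lemma hom_relations_kernel:
  assumes F: "assoc_algebra K F" and A: "assoc_algebra K A" and C: "assoc_algebra K C"
    and h: "h \<in> alg_hom K F C" and f: "f \<in> alg_hom K A C"
    and \<iota>: "\<iota> ` carrier A \<subseteq> carrier F" and eq: "\<And>a. a \<in> carrier A \<Longrightarrow> h (\<iota> a) = f a"
  shows "hom_relations K A F \<iota> \<subseteq> a_kernel F C h"
proof -
  interpret F: assoc_algebra K F by fact
  interpret A: assoc_algebra K A by fact
  interpret C: assoc_algebra K C by fact
  have "h \<in> ring_hom F C" using h by (simp add: alg_hom_def)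
  then interpret h: ring_hom_ring F C h
    by (intro ring_hom_ringI2 F.M.ring_axioms C.M.ring_axioms)
  have c: "\<iota> a \<in> carrier F" if "a \<in> carrier A" for a using \<iota> that by auto
  have diff: "x \<ominus>\<^bsub>F\<^esub> y \<in> a_kernel F C h" if "x \<in> carrier F" "y \<in> carrier F" "h x = h y" for x y
  proof -
    have "h (x \<ominus>\<^bsub>F\<^esub> y) = h x \<oplus>\<^bsub>C\<^esub> \<ominus>\<^bsub>C\<^esub> h y"
      unfolding F.M.minus_eq using that(1,2) by (simp only: h.hom_add h.hom_a_inv F.M.a_inv_closed)
    also have "\<dots> = \<zero>\<^bsub>C\<^esub>"
      unfolding that(3) using that(2) by (intro C.M.r_neg h.hom_closed)
    finally show ?thesis
      unfolding a_kernel_def' using that(1,2) by (intro CollectI conjI F.M.minus_closed)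
  qed
  note hD = alg_homD[OF h] and fD = alg_homD[OF f]
  have add: "\<iota> (x \<oplus>\<^bsub>A\<^esub> y) \<ominus>\<^bsub>F\<^esub> (\<iota> x \<oplus>\<^bsub>F\<^esub> \<iota> y) \<in> a_kernel F C h"
    and mult: "\<iota> (x \<otimes>\<^bsub>A\<^esub> y) \<ominus>\<^bsub>F\<^esub> (\<iota> x \<otimes>\<^bsub>F\<^esub> \<iota> y) \<in> a_kernel F C h"
    if xy: "x \<in> carrier A" "y \<in> carrier A" for x y
  proof -
    have "h (\<iota> (x \<oplus>\<^bsub>A\<^esub> y)) = h (\<iota> x \<oplus>\<^bsub>F\<^esub> \<iota> y)"
      using xy by (simp only: eq hD(2)[OF c c] fD(2) A.M.add.m_closed)
    then show "\<iota> (x \<oplus>\<^bsub>A\<^esub> y) \<ominus>\<^bsub>F\<^esub> (\<iota> x \<oplus>\<^bsub>F\<^esub> \<iota> y) \<in> a_kernel F C h"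
      by (intro diff c xy F.M.add.m_closed A.M.add.m_closed)
    have "h (\<iota> (x \<otimes>\<^bsub>A\<^esub> y)) = h (\<iota> x \<otimes>\<^bsub>F\<^esub> \<iota> y)"
      using xy by (simp only: eq hD(3)[OF c c] fD(3) A.M.m_closed)
    then show "\<iota> (x \<otimes>\<^bsub>A\<^esub> y) \<ominus>\<^bsub>F\<^esub> (\<iota> x \<otimes>\<^bsub>F\<^esub> \<iota> y) \<in> a_kernel F C h"
      by (intro diff c xy F.M.m_closed A.M.m_closed)
  qed
  have smult: "\<iota> (k \<odot>\<^bsub>A\<^esub> x) \<ominus>\<^bsub>F\<^esub> (k \<odot>\<^bsub>F\<^esub> \<iota> x) \<in> a_kernel F C h"
    if kx: "k \<in> carrier K" "x \<in> carrier A" for k x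
  proof -
    have "h (\<iota> (k \<odot>\<^bsub>A\<^esub> x)) = h (k \<odot>\<^bsub>F\<^esub> \<iota> x)"
      using kx by (simp only: eq hD(5)[OF _ c] fD(5) A.smult_closed)
    then show ?thesis by (intro diff c kx F.smult_closed A.smult_closed)
  qed
  have "h (\<iota> \<one>\<^bsub>A\<^esub>) = h \<one>\<^bsub>F\<^esub>" by (simp only: eq hD(4) fD(4) A.M.one_closed)
  then have one: "\<iota> \<one>\<^bsub>A\<^esub> \<ominus>\<^bsub>F\<^esub> \<one>\<^bsub>F\<^esub> \<in> a_kernel F C h"
    by (intro diff c F.M.one_closed A.M.one_closed)
  show ?thesis
    unfolding hom_relations_def
    by (intro Un_least subsetI; elim CollectE exE conjE singletonE; hypsubst)
       (intro add mult smult one; assumption)+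
qed

theorem free_product_inl_hom:
  assumes "assoc_algebra K A" "assoc_algebra K B"
  shows "free_product_inl K A B \<in> alg_hom K A (free_product K A B)"
proof -
  interpret A: assoc_algebra K A by fact
  have "(\<lambda>a. free_var K (Inl a)) ` carrier A \<subseteq> carrier (free_product_generators K A B)"
    by (auto intro!: free_var_carrier A.R.is_cring)
  from hom_relations_quotient[OF free_product_setup(1)[OF assms] assms(1) this
      free_product_setup(2)[OF assms]]
  show ?thesis by (simp add: free_product_inl_def[abs_def] free_product_def)
qed

theorem free_product_inr_hom:
  assumes "assoc_algebra K A" "assoc_algebra K B"
  shows "free_product_inr K A B \<in> alg_hom K B (free_product K A B)"
proof -
  interpret A: assoc_algebra K A by fact
  have "(\<lambda>b. free_var K (Inr b)) ` carrier B \<subseteq> carrier (free_product_generators K A B)"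
    by (auto intro!: free_var_carrier A.R.is_cring)
  from hom_relations_quotient[OF free_product_setup(1)[OF assms] assms(2) this
      free_product_setup(3)[OF assms]]
  show ?thesis by (simp add: free_product_inr_def[abs_def] free_product_def)
qed

lemma alg_hom_comp:
  assumes "g \<in> alg_hom K A B" "h \<in> alg_hom K B C"
  shows "h \<circ> g \<in> alg_hom K A C"
  by (rule alg_homI) (simp_all add: alg_homD[OF assms(1)] alg_homD[OF assms(2)])

theorem free_product_universal:
  assumes A: "assoc_algebra K A" and B: "assoc_algebra K B" and C: "assoc_algebra K C"
    and f: "f \<in> alg_hom K A C" and g: "g \<in> alg_hom K B C"
  shows "\<exists>h\<in>alg_hom K (free_product K A B) C.
    (\<forall>a\<in>carrier A. h (free_product_inl K A B a) = f a) \<and>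
    (\<forall>b\<in>carrier B. h (free_product_inr K A B b) = g b) \<and>
    (\<forall>h'\<in>alg_hom K (free_product K A B) C.
      (\<forall>a\<in>carrier A. h' (free_product_inl K A B a) = f a) \<longrightarrow>
      (\<forall>b\<in>carrier B. h' (free_product_inr K A B b) = g b) \<longrightarrow>
      (\<forall>x\<in>carrier (free_product K A B). h' x = h x))"
proof -
  interpret A: assoc_algebra K A by fact
  interpret C: assoc_algebra K C by fact
  let ?F = "free_product_generators K A B" and ?I = "free_product_ideal K A B"
  interpret Q: quotient_setup K ?F ?I by (rule free_product_setup(1)[OF A B])
  note v = free_var_carrier[OF A.R.is_cring]
  have "case_sum f g ` (carrier A <+> carrier B) \<subseteq> carrier C"
    using alg_homD(1)[OF f] alg_homD(1)[OF g] by auto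
  from free_algebra_universal[OF C this] obtain e where e: "e \<in> alg_hom K ?F C"
    and ev: "\<And>x. x \<in> carrier A <+> carrier B \<Longrightarrow> e (free_var K x) = case_sum f g x" by blast
  have "e \<in> ring_hom ?F C" using e by (simp add: alg_hom_def)
  then interpret e: ring_hom_ring ?F C e
    by (intro ring_hom_ringI2 Q.M.ring_axioms C.M.ring_axioms)
  have vl: "free_var K (Inl a) \<in> carrier ?F" and el: "e (free_var K (Inl a)) = f a"
    if "a \<in> carrier A" for a
    using v[OF InlI[OF that]] ev[OF InlI[OF that]] by (simp_all only: sum.case)
  have vr: "free_var K (Inr b) \<in> carrier ?F" and er: "e (free_var K (Inr b)) = g b"
    if "b \<in> carrier B" for b
    using v[OF InrI[OF that]] ev[OF InrI[OF that]] by (simp_all only: sum.case)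
  have "hom_relations K A ?F (\<lambda>a. free_var K (Inl a)) \<subseteq> a_kernel ?F C e"
    by (rule hom_relations_kernel[OF Q.is_assoc_algebra A C e f])
       (auto simp: vl el simp del: free_algebra_simps)
  moreover have "hom_relations K B ?F (\<lambda>b. free_var K (Inr b)) \<subseteq> a_kernel ?F C e"
    by (rule hom_relations_kernel[OF Q.is_assoc_algebra B C e g])
       (auto simp: vr er simp del: free_algebra_simps)
  ultimately have sub: "?I \<subseteq> a_kernel ?F C e"
    unfolding free_product_ideal_def by (intro Q.M.genideal_minimal e.kernel_is_ideal Un_least)
  have "e i = \<zero>\<^bsub>C\<^esub>" if "i \<in> ?I" for i
    using subsetD[OF sub that] unfolding a_kernel_def' by blast
  from Q.descend[OF C e this] obtain h where h: "h \<in> alg_hom K (free_product K A B) C"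
    and hc: "\<And>x. x \<in> carrier ?F \<Longrightarrow> h (Q.cls x) = e x"
    unfolding free_product_def by blast
  have hl: "h (free_product_inl K A B a) = f a" if "a \<in> carrier A" for a
    unfolding free_product_inl_def using hc[OF vl[OF that]] el[OF that] by (rule trans)
  have hr: "h (free_product_inr K A B b) = g b" if "b \<in> carrier B" for b
    unfolding free_product_inr_def using hc[OF vr[OF that]] er[OF that] by (rule trans)
  have "h' x = h x"
    if h': "h' \<in> alg_hom K (free_product K A B) C"
      and l: "\<forall>a\<in>carrier A. h' (free_product_inl K A B a) = f a"
      and r: "\<forall>b\<in>carrier B. h' (free_product_inr K A B b) = g b"
      and x: "x \<in> carrier (free_product K A B)" for h' x
  proof -
    obtain y where y: "y \<in> carrier ?F" "x = Q.cls y"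
      using Q.carrier_cls x unfolding free_product_def by blast
    have cls: "Q.cls \<in> alg_hom K ?F (free_product K A B)"
      unfolding free_product_def by (rule Q.cls_hom)
    have "(h' \<circ> Q.cls) y = (h \<circ> Q.cls) y"
    proof (rule free_algebra_hom_unique[OF C alg_hom_comp[OF cls h'] alg_hom_comp[OF cls h] _ y(1)])
      fix z assume "z \<in> carrier A <+> carrier B"
      then show "(h' \<circ> Q.cls) (free_var K z) = (h \<circ> Q.cls) (free_var K z)"
      proof (rule PlusE)
        fix a assume "a \<in> carrier A" "z = Inl a"
        then show ?thesis using l hl[of a] by (simp add: free_product_inl_def)
      next
        fix b assume "b \<in> carrier B" "z = Inr b"
        then show ?thesis using r hr[of b] by (simp add: free_product_inr_def)
      qed
    qed
    then show ?thesis by (simp add: y(2))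
  qed
  with h hl hr show ?thesis by blast
qed

section \<open>Algebras on a fixed carrier type\<close>

text \<open>Existence of an algebra has to be asserted on some carrier type. In the theorem it is
  \<open>(nat list \<Rightarrow> 'k) set\<close>, the type of the cosets in the free algebra on the generators
  \<open>0, 1, 2, \<dots>\<close>: as shown next, this type carries an isomorphic copy of every countably generated
  \<open>K\<close>-algebra (and of many larger ones).\<close>

lemma alg_transport:
  fixes C :: "('k, 'c, 'n) module_scheme" and \<theta> :: "'c \<Rightarrow> 'a"
  assumes "assoc_algebra K C" and inj: "inj_on \<theta> (carrier C)"
  shows "\<exists>A :: ('k, 'a) module. assoc_algebra K A \<and> \<theta> \<in> alg_hom K C A \<and>
    bij_betw \<theta> (carrier C) (carrier A)"
proof -
  interpret C: assoc_algebra K C by fact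
  define \<rho> where "\<rho> = inv_into (carrier C) \<theta>"
  define A :: "('k, 'a) module" where "A =
    \<lparr>carrier = \<theta> ` carrier C, mult = (\<lambda>x y. \<theta> (\<rho> x \<otimes>\<^bsub>C\<^esub> \<rho> y)), one = \<theta> \<one>\<^bsub>C\<^esub>, zero = \<theta> \<zero>\<^bsub>C\<^esub>,
     add = (\<lambda>x y. \<theta> (\<rho> x \<oplus>\<^bsub>C\<^esub> \<rho> y)), smult = (\<lambda>c x. \<theta> (c \<odot>\<^bsub>C\<^esub> \<rho> x))\<rparr>"
  have \<rho>: "\<rho> (\<theta> x) = x" if "x \<in> carrier C" for x
    using inj that by (simp add: \<rho>_def)
  have sel: "carrier A = \<theta> ` carrier C" "\<one>\<^bsub>A\<^esub> = \<theta> \<one>\<^bsub>C\<^esub>" "\<zero>\<^bsub>A\<^esub> = \<theta> \<zero>\<^bsub>C\<^esub>"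
    "\<And>x y. x \<otimes>\<^bsub>A\<^esub> y = \<theta> (\<rho> x \<otimes>\<^bsub>C\<^esub> \<rho> y)" "\<And>x y. x \<oplus>\<^bsub>A\<^esub> y = \<theta> (\<rho> x \<oplus>\<^bsub>C\<^esub> \<rho> y)"
    "\<And>c x. c \<odot>\<^bsub>A\<^esub> x = \<theta> (c \<odot>\<^bsub>C\<^esub> \<rho> x)"
    by (simp_all add: A_def)
  have ab: "abelian_group A"
  proof (rule abelian_groupI)
    fix x assume "x \<in> carrier A"
    then obtain y where "y \<in> carrier C" "x = \<theta> y" by (auto simp: sel)
    then show "\<exists>z\<in>carrier A. z \<oplus>\<^bsub>A\<^esub> x = \<zero>\<^bsub>A\<^esub>"
      by (intro bexI[of _ "\<theta> (\<ominus>\<^bsub>C\<^esub> y)"]) (auto simp: sel \<rho> C.M.l_neg)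
  qed (auto simp: sel \<rho> C.M.a_assoc C.M.a_comm C.M.a_lcomm)
  have "ring A"
  proof (rule ringI[OF ab])
    show "Group.monoid A" by (rule monoidI) (auto simp: sel \<rho> C.M.m_assoc)
  qed (auto simp: sel \<rho> C.M.l_distr C.M.r_distr)
  moreover have "module K A"
    by (rule moduleI[OF C.R.is_cring ab])
       (auto simp: sel \<rho> C.smult_l_distr C.smult_r_distr C.smult_assoc1)
  moreover have "assoc_algebra_axioms K A"
    by (rule assoc_algebra_axioms.intro)
       (auto simp: sel \<rho> C.smult_assoc_left C.smult_assoc_right)
  ultimately have "assoc_algebra K A" by (simp add: assoc_algebra_def)
  moreover have "\<theta> \<in> alg_hom K C A" by (rule alg_homI) (simp_all add: sel \<rho>)
  moreover have "bij_betw \<theta> (carrier C) (carrier A)" using inj by (simp add: bij_betw_def sel)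
  ultimately show ?thesis by blast
qed

theorem countably_generated_copy:
  fixes C :: "('k, 'c, 'n) module_scheme"
  assumes C: "assoc_algebra K C"
    and e: "e ` carrier (free_algebra K (UNIV :: nat set)) = carrier C"
  shows "\<exists>A :: ('k, (nat list \<Rightarrow> 'k) set) module. assoc_algebra K A \<and> alg_isomorphic K C A"
proof -
  define \<theta> where "\<theta> c = {p \<in> carrier (free_algebra K (UNIV :: nat set)). e p = c}" for c
  have "inj_on \<theta> (carrier C)"
  proof (rule inj_onI)
    fix x y assume "x \<in> carrier C" and eq: "\<theta> x = \<theta> y"
    then have "x \<in> e ` carrier (free_algebra K (UNIV :: nat set))" using e by simp
    then obtain p where "p \<in> \<theta> x" unfolding \<theta>_def by blast
    moreover from this have "p \<in> \<theta> y" using eq by simp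
    ultimately show "x = y" by (simp add: \<theta>_def)
  qed
  from alg_transport[OF C this] show ?thesis unfolding alg_isomorphic_def by blast
qed

end

theory Submission
  imports Defs "HOL-Algebra.Ring_Divisibility"
begin

text \<open>Let \<open>A\<close> be a simple algebra with elements satisfying \<open>b\<^sub>i a\<^sub>j = \<delta>\<^sub>i\<^sub>j\<close> and \<open>a\<^sub>1 b\<^sub>1 + a\<^sub>2 b\<^sub>2 = 1\<close>.
  Then \<open>x = a\<^sub>1 y + a\<^sub>2 z\<close> with \<open>y = b\<^sub>1 x\<close>, \<open>z = b\<^sub>2 x\<close> identifies \<open>A * K\<langle>x\<rangle>\<close> with
  \<open>A * K\<langle>y, z\<rangle>\<close>, so \<open>A\<close> and \<open>B = A * K\<langle>x\<rangle>\<close> become isomorphic after adjoining one variable. They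
  are not isomorphic: \<open>B\<close> maps to \<open>A\<close> by \<open>x \<mapsto> 0\<close>, so \<open>B\<close> is not simple. Such an \<open>A\<close>
  is the quotient of a free algebra by a maximal ideal containing the relations; these generate a
  proper ideal because they hold for operators on the nonzero space of sequences in \<open>K\<close>.\<close>

section \<open>Homomorphisms and isomorphisms\<close>

lemma alg_hom_inv:
  assumes A: "assoc_algebra K A" and h: "h \<in> alg_hom K A B"
    and bij: "bij_betw h (carrier A) (carrier B)"
  shows "inv_into (carrier A) h \<in> alg_hom K B A"
proof -
  interpret A: assoc_algebra K A by fact
  let ?g = "inv_into (carrier A) h"
  have g: "?g y \<in> carrier A" "h (?g y) = y" if "y \<in> carrier B" for y
    using bij that by (auto simp: bij_betw_def inv_into_into f_inv_into_f)
  have gh: "?g (h x) = x" if "x \<in> carrier A" for x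
    using bij that by (auto simp: bij_betw_def)
  show ?thesis
  proof (rule alg_homI)
    fix x y assume x: "x \<in> carrier B" and y: "y \<in> carrier B"
    have "?g (h (?g x \<oplus>\<^bsub>A\<^esub> ?g y)) = ?g x \<oplus>\<^bsub>A\<^esub> ?g y"
      by (intro gh A.M.a_closed g x y)
    then show "?g (x \<oplus>\<^bsub>B\<^esub> y) = ?g x \<oplus>\<^bsub>A\<^esub> ?g y"
      by (simp only: alg_homD(2)[OF h] g x y)
    have "?g (h (?g x \<otimes>\<^bsub>A\<^esub> ?g y)) = ?g x \<otimes>\<^bsub>A\<^esub> ?g y"
      by (intro gh A.M.m_closed g x y)
    then show "?g (x \<otimes>\<^bsub>B\<^esub> y) = ?g x \<otimes>\<^bsub>A\<^esub> ?g y"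
      by (simp only: alg_homD(3)[OF h] g x y)
  next
    show "?g \<one>\<^bsub>B\<^esub> = \<one>\<^bsub>A\<^esub>" using gh[of "\<one>\<^bsub>A\<^esub>"] alg_homD(4)[OF h] by simp
  next
    fix c y assume c: "c \<in> carrier K" and y: "y \<in> carrier B"
    have "?g (h (c \<odot>\<^bsub>A\<^esub> ?g y)) = c \<odot>\<^bsub>A\<^esub> ?g y"
      by (intro gh A.smult_closed c g y)
    then show "?g (c \<odot>\<^bsub>B\<^esub> y) = c \<odot>\<^bsub>A\<^esub> ?g y"
      by (simp only: alg_homD(5)[OF h] c g y)
  qed (rule g)
qed

lemma alg_isomorphic_obtain:
  assumes A: "assoc_algebra K A" and iso: "alg_isomorphic K A B"
  obtains f g where "f \<in> alg_hom K A B" "g \<in> alg_hom K B A"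
    "\<And>x. x \<in> carrier A \<Longrightarrow> g (f x) = x" "\<And>y. y \<in> carrier B \<Longrightarrow> f (g y) = y"
proof -
  obtain f where f: "f \<in> alg_hom K A B" "bij_betw f (carrier A) (carrier B)"
    using iso by (auto simp: alg_isomorphic_def)
  show thesis
    by (rule that[OF f(1) alg_hom_inv[OF A f]])
      (use f(2) in \<open>auto simp: bij_betw_def f_inv_into_f\<close>)
qed

lemma alg_isomorphicI:
  assumes "f \<in> alg_hom K A B" "g \<in> alg_hom K B A"
    and "\<And>x. x \<in> carrier A \<Longrightarrow> g (f x) = x" "\<And>y. y \<in> carrier B \<Longrightarrow> f (g y) = y"
  shows "alg_isomorphic K A B"
  unfolding alg_isomorphic_def
  using assms by (intro bexI[of _ f] bij_betw_byWitness[where f' = g]) (auto intro: alg_homD(1))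

lemma alg_hom_id: "(\<lambda>x. x) \<in> alg_hom K A A"
  by (rule alg_homI) auto

lemma alg_hom_kernel_ideal:
  assumes A: "assoc_algebra K A" and B: "assoc_algebra K B" and h: "h \<in> alg_hom K A B"
  shows "ideal (a_kernel A B h) A"
proof -
  interpret A: assoc_algebra K A by fact
  interpret B: assoc_algebra K B by fact
  have "h \<in> ring_hom A B" using h by (simp add: alg_hom_def)
  then interpret h: ring_hom_ring A B h
    by (intro ring_hom_ringI2 A.M.ring_axioms B.M.ring_axioms)
  show ?thesis by (rule h.kernel_is_ideal)
qed

text \<open>Converts equal values into membership in an ideal, the form in which
  \<open>cls_eqI\<close> identifies two cosets.\<close>

lemma alg_hom_kernel_diff:
  assumes A: "assoc_algebra K A" and B: "assoc_algebra K B" and h: "h \<in> alg_hom K A B"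
    and xy: "x \<in> carrier A" "y \<in> carrier A" "h x = h y"
  shows "x \<ominus>\<^bsub>A\<^esub> y \<in> a_kernel A B h"
proof -
  interpret A: assoc_algebra K A by fact
  interpret B: assoc_algebra K B by fact
  have "h \<in> ring_hom A B" using h by (simp add: alg_hom_def)
  then interpret h: ring_hom_ring A B h
    by (intro ring_hom_ringI2 A.M.ring_axioms B.M.ring_axioms)
  have "h (x \<ominus>\<^bsub>A\<^esub> y) = h x \<oplus>\<^bsub>B\<^esub> \<ominus>\<^bsub>B\<^esub> h y"
    unfolding A.M.minus_eq using xy by (simp only: h.hom_add h.hom_a_inv A.M.a_inv_closed)
  also have "\<dots> = \<zero>\<^bsub>B\<^esub>" unfolding xy(3) by (intro B.M.r_neg h.hom_closed xy)
  finally show ?thesis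
    unfolding a_kernel_def' by (intro CollectI conjI A.M.minus_closed xy)
qed

section \<open>Maximal two-sided ideals\<close>

text \<open>Zorn's lemma on the two-sided ideals above \<open>I\<close> that avoid
  \<open>\<one>\<close>. Properness is expressed by a single missing element, so the union of a
  nonempty chain inherits it.\<close>

lemma (in ring) maximal_ideal_exists:
  assumes "ideal I R" "\<one> \<notin> I"
  obtains J where "ideal J R" "I \<subseteq> J" "\<one> \<notin> J"
    "\<And>L. ideal L R \<Longrightarrow> J \<subseteq> L \<Longrightarrow> \<one> \<notin> L \<Longrightarrow> L = J"
proof -
  let ?S = "{J. ideal J R \<and> I \<subseteq> J \<and> \<one> \<notin> J}"
  have "\<exists>J\<in>?S. \<forall>L\<in>?S. J \<subseteq> L \<longrightarrow> L = J"
  proof (rule subset_Zorn_nonempty)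
    show "?S \<noteq> {}" using assms by blast
  next
    fix C assume C: "C \<noteq> {}" "subset.chain ?S C"
    have "subset.chain {J. ideal J R} C"
      using C(2) unfolding subset_chain_def by blast
    then have "ideal (\<Union>C) R" using chain_Union_is_ideal[of C] C(1) by simp
    moreover have "I \<subseteq> \<Union>C" "\<one> \<notin> \<Union>C"
      using C unfolding subset_chain_def by blast+
    ultimately show "\<Union>C \<in> ?S" by simp
  qed
  then obtain J where J: "ideal J R" "I \<subseteq> J" "\<one> \<notin> J"
    and max: "\<forall>L\<in>?S. J \<subseteq> L \<longrightarrow> L = J" by blast
  show thesis
  proof (rule that[OF J])
    fix L assume "ideal L R" "J \<subseteq> L" "\<one> \<notin> L"
    then show "L = J" using max J(2) by blast
  qed
qed

section \<open>Endomorphism algebras\<close>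

text \<open>Operators are extensional, that is \<open>undefined\<close> off the carrier, so that two
  operators agreeing on the carrier are equal; the algebra laws can then hold as equations between
  functions.\<close>

definition endo_algebra ::
  "('k, 'm) ring_scheme \<Rightarrow> ('k, 'a, 'n) module_scheme \<Rightarrow> ('k, 'a \<Rightarrow> 'a) module"
  where "endo_algebra K M =
    \<lparr>carrier = {T \<in> carrier M \<rightarrow>\<^sub>E carrier M.
       (\<forall>x\<in>carrier M. \<forall>y\<in>carrier M. T (x \<oplus>\<^bsub>M\<^esub> y) = T x \<oplus>\<^bsub>M\<^esub> T y) \<and>
       (\<forall>c\<in>carrier K. \<forall>x\<in>carrier M. T (c \<odot>\<^bsub>M\<^esub> x) = c \<odot>\<^bsub>M\<^esub> T x)},
     monoid.mult = compose (carrier M),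
     one = (\<lambda>x\<in>carrier M. x),
     zero = (\<lambda>x\<in>carrier M. \<zero>\<^bsub>M\<^esub>),
     add = (\<lambda>S T. \<lambda>x\<in>carrier M. S x \<oplus>\<^bsub>M\<^esub> T x),
     smult = (\<lambda>c T. \<lambda>x\<in>carrier M. c \<odot>\<^bsub>M\<^esub> T x)\<rparr>"

text \<open>Every law is checked at one vector at a time: \<open>app\<close> evaluates the
  operations, and extensionality lifts the pointwise identity to operators.\<close>

lemma (in Module.module) endo_assoc_algebra: "assoc_algebra R (endo_algebra R M)"
proof -
  let ?E = "endo_algebra R M"
  have val: "T x \<in> carrier M" if "T \<in> carrier ?E" "x \<in> carrier M" for T x
    using that by (auto simp: endo_algebra_def)
  have lin: "T (x \<oplus>\<^bsub>M\<^esub> y) = T x \<oplus>\<^bsub>M\<^esub> T y" "c \<in> carrier R \<Longrightarrow> T (c \<odot>\<^bsub>M\<^esub> x) = c \<odot>\<^bsub>M\<^esub> T x"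
    if "T \<in> carrier ?E" "x \<in> carrier M" "y \<in> carrier M" for T x y c
    using that by (auto simp: endo_algebra_def)
  have memI: "T \<in> carrier ?E"
    if "T \<in> extensional (carrier M)" "\<And>x. x \<in> carrier M \<Longrightarrow> T x \<in> carrier M"
      "\<And>x y. x \<in> carrier M \<Longrightarrow> y \<in> carrier M \<Longrightarrow> T (x \<oplus>\<^bsub>M\<^esub> y) = T x \<oplus>\<^bsub>M\<^esub> T y"
      "\<And>c x. c \<in> carrier R \<Longrightarrow> x \<in> carrier M \<Longrightarrow> T (c \<odot>\<^bsub>M\<^esub> x) = c \<odot>\<^bsub>M\<^esub> T x" for T
    using that by (auto simp: endo_algebra_def PiE_def)
  note ext = extensionalityI[where A = "carrier M"]
  have exE: "T \<in> extensional (carrier M)" if "T \<in> carrier ?E" for T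
    using that by (auto simp: endo_algebra_def PiE_def)
  have ops: "S \<otimes>\<^bsub>?E\<^esub> T = compose (carrier M) S T" "\<one>\<^bsub>?E\<^esub> = (\<lambda>x\<in>carrier M. x)"
    "\<zero>\<^bsub>?E\<^esub> = (\<lambda>x\<in>carrier M. \<zero>\<^bsub>M\<^esub>)" "S \<oplus>\<^bsub>?E\<^esub> T = (\<lambda>x\<in>carrier M. S x \<oplus>\<^bsub>M\<^esub> T x)"
    "c \<odot>\<^bsub>?E\<^esub> T = (\<lambda>x\<in>carrier M. c \<odot>\<^bsub>M\<^esub> T x)" for S T c
    by (simp_all add: endo_algebra_def)
  have app: "x \<in> carrier M \<Longrightarrow> (S \<otimes>\<^bsub>?E\<^esub> T) x = S (T x)" "x \<in> carrier M \<Longrightarrow> \<one>\<^bsub>?E\<^esub> x = x"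
    "x \<in> carrier M \<Longrightarrow> \<zero>\<^bsub>?E\<^esub> x = \<zero>\<^bsub>M\<^esub>" "x \<in> carrier M \<Longrightarrow> (S \<oplus>\<^bsub>?E\<^esub> T) x = S x \<oplus>\<^bsub>M\<^esub> T x"
    "x \<in> carrier M \<Longrightarrow> (c \<odot>\<^bsub>?E\<^esub> T) x = c \<odot>\<^bsub>M\<^esub> T x" for S T c x
    by (simp_all add: ops compose_def)
  have exO: "S \<otimes>\<^bsub>?E\<^esub> T \<in> extensional (carrier M)" "\<one>\<^bsub>?E\<^esub> \<in> extensional (carrier M)"
    "\<zero>\<^bsub>?E\<^esub> \<in> extensional (carrier M)" "S \<oplus>\<^bsub>?E\<^esub> T \<in> extensional (carrier M)"
    "c \<odot>\<^bsub>?E\<^esub> T \<in> extensional (carrier M)" for S T c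
    by (simp_all add: ops)
  have add_cl: "S \<oplus>\<^bsub>?E\<^esub> T \<in> carrier ?E" if "S \<in> carrier ?E" "T \<in> carrier ?E" for S T
    by (rule memI) (simp_all add: exO app val lin that M.a_ac smult_r_distr)
  have mult_cl: "S \<otimes>\<^bsub>?E\<^esub> T \<in> carrier ?E" if "S \<in> carrier ?E" "T \<in> carrier ?E" for S T
    by (rule memI) (simp_all add: exO app val lin that)
  have zero_cl: "\<zero>\<^bsub>?E\<^esub> \<in> carrier ?E" and one_cl: "\<one>\<^bsub>?E\<^esub> \<in> carrier ?E"
    by (rule memI; simp add: exO app)+
  have smult_cl: "c \<odot>\<^bsub>?E\<^esub> T \<in> carrier ?E" if "c \<in> carrier R" "T \<in> carrier ?E" for c T
  proof (rule memI)
    show "(c \<odot>\<^bsub>?E\<^esub> T) (d \<odot>\<^bsub>M\<^esub> x) = d \<odot>\<^bsub>M\<^esub> (c \<odot>\<^bsub>?E\<^esub> T) x"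
      if "d \<in> carrier R" "x \<in> carrier M" for d x
    proof -
      \<comment> \<open>Commutativity of \<open>R\<close> is what makes a scalar multiple of a
        linear operator linear again.\<close>
      have "c \<odot>\<^bsub>M\<^esub> (d \<odot>\<^bsub>M\<^esub> T x) = d \<odot>\<^bsub>M\<^esub> (c \<odot>\<^bsub>M\<^esub> T x)"
        using that \<open>c \<in> carrier R\<close> \<open>T \<in> carrier ?E\<close> by (simp add: val R.m_comm flip: smult_assoc1)
      then show ?thesis using that \<open>T \<in> carrier ?E\<close> by (simp add: app lin)
    qed
  qed (simp_all add: exO app val lin that smult_r_distr)
  note cl = add_cl mult_cl zero_cl one_cl smult_cl
  have ab: "abelian_group ?E"
  proof (rule abelian_groupI)
    fix T assume T: "T \<in> carrier ?E"
    define N where "N = (\<lambda>x\<in>carrier M. \<ominus>\<^bsub>M\<^esub> T x)"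
    have "N \<in> carrier ?E"
      by (rule memI) (simp_all add: N_def val lin T M.minus_add smult_r_minus)
    moreover have "N \<oplus>\<^bsub>?E\<^esub> T = \<zero>\<^bsub>?E\<^esub>"
      by (rule ext) (simp_all add: exO app N_def val T M.l_neg)
    ultimately show "\<exists>S\<in>carrier ?E. S \<oplus>\<^bsub>?E\<^esub> T = \<zero>\<^bsub>?E\<^esub>" by blast
  qed (auto intro!: cl ext exO exE simp: app val M.a_ac)
  have "ring ?E"
  proof (rule ringI[OF ab])
    show "Group.monoid ?E"
      by (rule monoidI) (auto intro!: cl ext exO exE simp: app val cl)
  qed (auto intro!: cl ext exO exE simp: app val lin cl)
  moreover have "Module.module R ?E"
    by (rule moduleI[OF R.is_cring ab])
      (auto intro!: cl ext exO exE simp: app val smult_l_distr smult_r_distr smult_assoc1)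
  moreover have "assoc_algebra_axioms R ?E"
    by (rule assoc_algebra_axioms.intro) (auto intro!: cl ext exO exE simp: app val lin)
  ultimately show ?thesis by (simp add: assoc_algebra_def)
qed

definition fun_module :: "('k, 'm) ring_scheme \<Rightarrow> ('k, 'x \<Rightarrow> 'k) module"
  where "fun_module K =
    \<lparr>carrier = {v. range v \<subseteq> carrier K}, monoid.mult = (\<lambda>v w x. v x \<otimes>\<^bsub>K\<^esub> w x), one = (\<lambda>x. \<one>\<^bsub>K\<^esub>),
     zero = (\<lambda>x. \<zero>\<^bsub>K\<^esub>), add = (\<lambda>v w x. v x \<oplus>\<^bsub>K\<^esub> w x), smult = (\<lambda>c v x. c \<otimes>\<^bsub>K\<^esub> v x)\<rparr>"

lemma (in cring) fun_module: "Module.module R (fun_module R)"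
proof -
  have "abelian_group (fun_module R)"
  proof (rule abelian_groupI)
    fix v assume "v \<in> carrier (fun_module R)"
    then show "\<exists>w\<in>carrier (fun_module R). w \<oplus>\<^bsub>fun_module R\<^esub> v = \<zero>\<^bsub>fun_module R\<^esub>"
      by (intro bexI[of _ "\<lambda>x. \<ominus> v x"]) (auto simp: fun_module_def image_subset_iff l_neg)
  qed (auto simp: fun_module_def image_subset_iff a_ac)
  then show ?thesis
    by (intro moduleI)
      (auto simp: fun_module_def image_subset_iff is_cring l_distr r_distr m_assoc)
qed

section \<open>A simple algebra isomorphic to its square as a left module\<close>

text \<open>The defining relations of the Leavitt algebra \<open>L(1,2)\<close>.\<close>

definition leavitt_relations ::
  "('a, 'n) ring_scheme \<Rightarrow> 'a \<Rightarrow> 'a \<Rightarrow> 'a \<Rightarrow> 'a \<Rightarrow> bool"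
  where "leavitt_relations A a1 a2 b1 b2 \<longleftrightarrow>
    {a1, a2, b1, b2} \<subseteq> carrier A \<and>
    b1 \<otimes>\<^bsub>A\<^esub> a1 = \<one>\<^bsub>A\<^esub> \<and> b2 \<otimes>\<^bsub>A\<^esub> a2 = \<one>\<^bsub>A\<^esub> \<and>
    b1 \<otimes>\<^bsub>A\<^esub> a2 = \<zero>\<^bsub>A\<^esub> \<and> b2 \<otimes>\<^bsub>A\<^esub> a1 = \<zero>\<^bsub>A\<^esub> \<and>
    a1 \<otimes>\<^bsub>A\<^esub> b1 \<oplus>\<^bsub>A\<^esub> a2 \<otimes>\<^bsub>A\<^esub> b2 = \<one>\<^bsub>A\<^esub>"

text \<open>The relations are equations between ring expressions. Since \<open>alg_hom\<close>
  mentions only the unit, preservation of zero is brought in by \<open>alg_hom_zero\<close>.\<close>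

lemma leavitt_relations_hom:
  assumes "assoc_algebra K A" "assoc_algebra K B" "h \<in> alg_hom K A B"
    and "leavitt_relations A a1 a2 b1 b2"
  shows "leavitt_relations B (h a1) (h a2) (h b1) (h b2)"
proof -
  interpret A: assoc_algebra K A by fact
  note D = alg_homD[OF assms(3)] alg_hom_zero[OF assms(1-3)]
  from assms(4) show ?thesis
    unfolding leavitt_relations_def by (auto simp: D simp flip: D(2-4))
qed

text \<open>A sequence amounts to the pair of its even and odd parts, so the space of sequences is
  the direct sum of two copies of itself. The relations record the two inclusions and the two
  projections.\<close>

lemma leavitt_relations_endo:
  fixes K :: "('k, 'm) ring_scheme"
  assumes "field K"
  defines "E \<equiv> endo_algebra K (fun_module K :: ('k, nat \<Rightarrow> 'k) module)"
  shows "\<exists>a1 a2 b1 b2. leavitt_relations E a1 a2 b1 b2" and "\<one>\<^bsub>E\<^esub> \<noteq> \<zero>\<^bsub>E\<^esub>"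
proof -
  interpret field K by fact
  let ?V = "carrier (fun_module K :: ('k, nat \<Rightarrow> 'k) module)"
  \<comment> \<open>For \<open>i < 2\<close>, \<open>b i\<close> extracts the terms at positions of
    parity \<open>i\<close>, and \<open>a i\<close> spreads a sequence over these positions with
    zeros elsewhere.\<close>
  define b where "b i = (\<lambda>v\<in>?V. \<lambda>n. v (2 * n + i))" for i :: nat
  define a where "a i = (\<lambda>v\<in>?V. \<lambda>n. if n mod 2 = i then v (n div 2) else \<zero>\<^bsub>K\<^esub>)" for i :: nat
  have V: "v \<in> ?V \<longleftrightarrow> (\<forall>n. v n \<in> carrier K)" for v
    by (auto simp: fun_module_def)
  have ab: "a i \<in> carrier E" "b i \<in> carrier E" for i
    by (auto simp: E_def endo_algebra_def fun_module_def a_def b_def image_subset_iff)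
  have V_ab: "a i v \<in> ?V" "b i v \<in> ?V" if "v \<in> ?V" for i v
    using that by (auto simp: a_def b_def V)
  have one: "b i \<otimes>\<^bsub>E\<^esub> a i = \<one>\<^bsub>E\<^esub>" if "i < 2" for i
    using that V_ab
    by (auto simp: E_def endo_algebra_def compose_def b_def a_def intro!: restrict_ext)
  have zero: "b i \<otimes>\<^bsub>E\<^esub> a j = \<zero>\<^bsub>E\<^esub>" if "i < 2" "i \<noteq> j" for i j
    using that V_ab
    by (auto simp: E_def endo_algebra_def compose_def b_def a_def fun_module_def intro!: restrict_ext)
  have sum: "a 0 \<otimes>\<^bsub>E\<^esub> b 0 \<oplus>\<^bsub>E\<^esub> a 1 \<otimes>\<^bsub>E\<^esub> b 1 = \<one>\<^bsub>E\<^esub>"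
  proof -
    have "a 0 (b 0 v) n \<oplus>\<^bsub>K\<^esub> a 1 (b 1 v) n = v n" if "v \<in> ?V" for v n
    proof -
      have "v n \<in> carrier K" using that V by blast
      \<comment> \<open>By the parity of \<open>n\<close>, one summand is zero and the other returns
        \<open>v n\<close>.\<close>
      moreover have "n mod 2 = 0 \<and> 2 * (n div 2) = n \<or> n mod 2 = 1 \<and> Suc (2 * (n div 2)) = n"
        by presburger
      ultimately show ?thesis
        using that V_ab(2)[OF that, of 0] V_ab(2)[OF that, of 1]
        by (auto simp: a_def b_def)
    qed
    then show ?thesis
      by (auto simp: E_def endo_algebra_def compose_def fun_module_def intro!: restrict_ext)
  qed
  have "leavitt_relations E (a 0) (a 1) (b 0) (b 1)"
    unfolding leavitt_relations_def using ab one[of 0] one[of 1] zero[of 0 1] zero[of 1 0] sum by simp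
  then show "\<exists>a1 a2 b1 b2. leavitt_relations E a1 a2 b1 b2" by blast
  \<comment> \<open>The constant sequence \<open>\<one>\<close> separates the identity from the zero
    operator, because \<open>\<one> \<noteq> \<zero>\<close> in a field.\<close>
  have "(\<lambda>n. \<one>\<^bsub>K\<^esub>) \<in> ?V" by (simp add: V)
  then have "\<one>\<^bsub>E\<^esub> (\<lambda>n. \<one>\<^bsub>K\<^esub>) 0 \<noteq> \<zero>\<^bsub>E\<^esub> (\<lambda>n. \<one>\<^bsub>K\<^esub>) 0"
    by (simp add: E_def endo_algebra_def fun_module_def)
  then show "\<one>\<^bsub>E\<^esub> \<noteq> \<zero>\<^bsub>E\<^esub>" by metis
qed

text \<open>Simplicity enters in the form that all unital endomorphisms are injective. The
  surjection \<open>p\<close> certifies countable generation, which later lets a copy of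
  \<open>A * K<x>\<close> live on the same type as \<open>A\<close>.\<close>

lemma simple_leavitt_algebra:
  fixes K :: "('k, 'm) ring_scheme"
  assumes "field K"
  obtains A :: "('k, (nat list \<Rightarrow> 'k) set) module" and a1 a2 b1 b2 p
  where "assoc_algebra K A" "\<one>\<^bsub>A\<^esub> \<noteq> \<zero>\<^bsub>A\<^esub>" "leavitt_relations A a1 a2 b1 b2"
    "p \<in> alg_hom K (free_algebra K (UNIV :: nat set)) A"
    "p ` carrier (free_algebra K (UNIV :: nat set)) = carrier A"
    "\<And>e. e \<in> alg_hom K A A \<Longrightarrow> inj_on e (carrier A)"
proof -
  interpret field K by fact
  let ?F = "free_algebra K (UNIV :: nat set)"
  let ?E = "endo_algebra K (fun_module K :: ('k, nat \<Rightarrow> 'k) module)"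
  have E: "assoc_algebra K ?E" by (rule module.endo_assoc_algebra[OF fun_module])
  interpret F: assoc_algebra K ?F by (rule free_assoc_algebra)
  obtain a1 a2 b1 b2 where rel: "leavitt_relations ?E a1 a2 b1 b2"
    using leavitt_relations_endo(1)[OF assms] by blast
  \<comment> \<open>Four operators suffice, but the carrier type prescribes generators indexed by
    all natural numbers; every index from 3 on is sent to \<open>b2\<close>.\<close>
  define \<phi> where "\<phi> = (\<lambda>n::nat. if n = 0 then a1 else if n = 1 then a2 else if n = 2 then b1 else b2)"
  have "\<phi> ` UNIV \<subseteq> carrier ?E" using rel by (auto simp: \<phi>_def leavitt_relations_def)
  from free_algebra_universal[OF E this] obtain e where e: "e \<in> alg_hom K ?F ?E"
    and e\<phi>: "\<And>n. e (free_var K n) = \<phi> n" by auto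
  let ?I = "a_kernel ?F ?E e"
  have I: "ideal ?I ?F" by (rule alg_hom_kernel_ideal[OF F.is_assoc_algebra E e])
  \<comment> \<open>The kernel is proper because \<open>e\<close> maps the unit to the identity
    operator, which is nonzero.\<close>
  have "\<one>\<^bsub>?F\<^esub> \<notin> ?I"
    using leavitt_relations_endo(2)[OF assms] alg_homD(4)[OF e]
    by (simp add: a_kernel_def' del: free_algebra_simps)
  from F.M.maximal_ideal_exists[OF I this] obtain J where J: "ideal J ?F" "?I \<subseteq> J" "\<one>\<^bsub>?F\<^esub> \<notin> J"
    and max: "\<And>L. ideal L ?F \<Longrightarrow> J \<subseteq> L \<Longrightarrow> \<one>\<^bsub>?F\<^esub> \<notin> L \<Longrightarrow> L = J" by blast
  interpret Q: quotient_setup K ?F J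
    by (intro quotient_setup.intro F.is_assoc_algebra J)
  have Q: "assoc_algebra K Q.Q" by (rule Q.quotient_assoc_algebra)
  have cls: "Q.cls \<in> alg_hom K ?F Q.Q" by (rule Q.cls_hom)
  note cD = alg_homD[OF cls] alg_hom_zero[OF F.is_assoc_algebra Q cls]
  note eD = alg_homD[OF e] alg_hom_zero[OF F.is_assoc_algebra E e]
  have J0: "x \<in> J" if "x \<in> carrier ?F" "Q.cls x = \<zero>\<^bsub>Q.Q\<^esub>" for x
    using that Q.a_rcos_self[of x] by (simp add: quotient_algebra_simps FactRing_def)
  \<comment> \<open>As \<open>J\<close> contains the kernel of \<open>e\<close>, any equation true
    of the operators stays true in the quotient by \<open>J\<close>.\<close>
  have eq: "Q.cls x = Q.cls y" if xy: "x \<in> carrier ?F" "y \<in> carrier ?F" "e x = e y" for x y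
    using J(2) alg_hom_kernel_diff[OF F.is_assoc_algebra E e, OF xy] by (intro Q.cls_eqI xy(1,2)) blast
  let ?x = "\<lambda>n::nat. free_var K n"
  have x: "?x n \<in> carrier ?F" for n by (intro free_var_carrier is_cring UNIV_I)
  have rel': "leavitt_relations Q.Q (Q.cls (?x 0)) (Q.cls (?x 1)) (Q.cls (?x 2)) (Q.cls (?x 3))"
  proof -
    note F = F.M.m_closed F.M.a_closed F.M.one_closed F.M.zero_closed
    \<comment> \<open>Products and sums of classes are merged into single classes, so that each
      relation becomes an instance of \<open>eq\<close>.\<close>
    have mm: "Q.cls (?x i) \<otimes>\<^bsub>Q.Q\<^esub> Q.cls (?x j) = Q.cls (?x i \<otimes>\<^bsub>?F\<^esub> ?x j)" for i j
      by (rule cD(3)[symmetric]) (rule x)+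
    have ss: "Q.cls (?x i \<otimes>\<^bsub>?F\<^esub> ?x j) \<oplus>\<^bsub>Q.Q\<^esub> Q.cls (?x k \<otimes>\<^bsub>?F\<^esub> ?x l)
      = Q.cls (?x i \<otimes>\<^bsub>?F\<^esub> ?x j \<oplus>\<^bsub>?F\<^esub> ?x k \<otimes>\<^bsub>?F\<^esub> ?x l)" for i j k l
      by (rule cD(2)[symmetric]) (intro F x)+
    have one: "Q.cls (?x i \<otimes>\<^bsub>?F\<^esub> ?x j) = Q.cls \<one>\<^bsub>?F\<^esub>" if "\<phi> i \<otimes>\<^bsub>?E\<^esub> \<phi> j = \<one>\<^bsub>?E\<^esub>" for i j
      by (rule eq) (intro F x | simp only: eD x e\<phi> that)+
    have zero: "Q.cls (?x i \<otimes>\<^bsub>?F\<^esub> ?x j) = Q.cls \<zero>\<^bsub>?F\<^esub>" if "\<phi> i \<otimes>\<^bsub>?E\<^esub> \<phi> j = \<zero>\<^bsub>?E\<^esub>" for i j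
      by (rule eq) (intro F x | simp only: eD x e\<phi> that)+
    have sum: "Q.cls (?x i \<otimes>\<^bsub>?F\<^esub> ?x j \<oplus>\<^bsub>?F\<^esub> ?x k \<otimes>\<^bsub>?F\<^esub> ?x l) = Q.cls \<one>\<^bsub>?F\<^esub>"
      if "\<phi> i \<otimes>\<^bsub>?E\<^esub> \<phi> j \<oplus>\<^bsub>?E\<^esub> \<phi> k \<otimes>\<^bsub>?E\<^esub> \<phi> l = \<one>\<^bsub>?E\<^esub>" for i j k l
      by (rule eq) (intro F x | simp only: eD x e\<phi> that F)+
    have \<phi>_rel: "leavitt_relations ?E (\<phi> 0) (\<phi> 1) (\<phi> 2) (\<phi> 3)"
      using rel by (simp add: \<phi>_def)
    show ?thesis
      unfolding leavitt_relations_def mm ss cD(4,6)[symmetric]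
      using \<phi>_rel unfolding leavitt_relations_def
      by (intro conjI one zero sum) (use x cD(1) in \<open>blast+\<close>)
  qed
  have nz: "\<one>\<^bsub>Q.Q\<^esub> \<noteq> \<zero>\<^bsub>Q.Q\<^esub>"
    using J0[OF F.M.one_closed] J(3) cD(4) by metis
  show thesis
  proof (rule that[OF Q nz rel' cls])
    show "Q.cls ` carrier ?F = carrier Q.Q"
      using Q.carrier_cls cD(1) by blast
  next
    fix h assume h: "h \<in> alg_hom K Q.Q Q.Q"
    have hc: "h \<circ> Q.cls \<in> alg_hom K ?F Q.Q" by (rule alg_hom_comp[OF cls h])
    \<comment> \<open>The kernel of \<open>h\<close> is pulled back to the free algebra. It contains
      \<open>J\<close> and misses the unit, so maximality makes it equal to \<open>J\<close>, which
      means that \<open>h\<close> is injective.\<close>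
    let ?L = "a_kernel ?F Q.Q (h \<circ> Q.cls)"
    have L: "ideal ?L ?F" by (rule alg_hom_kernel_ideal[OF F.is_assoc_algebra Q hc])
    have "J \<subseteq> ?L"
    proof
      fix i assume "i \<in> J"
      then show "i \<in> ?L"
        using Q.Icarr alg_hom_zero[OF Q Q h] by (simp add: a_kernel_def' Q.cls_eq_zero)
    qed
    moreover have "\<one>\<^bsub>?F\<^esub> \<notin> ?L"
      using nz alg_homD(4)[OF hc] unfolding a_kernel_def' by simp
    ultimately have LJ: "?L = J" by (rule max[OF L])
    show "inj_on h (carrier Q.Q)"
    proof (rule inj_onI)
      fix u v assume "u \<in> carrier Q.Q" "v \<in> carrier Q.Q" and huv: "h u = h v"
      then obtain y z where y: "y \<in> carrier ?F" "u = Q.cls y" and z: "z \<in> carrier ?F" "v = Q.cls z"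
        using Q.carrier_cls by meson
      have "(h \<circ> Q.cls) y = (h \<circ> Q.cls) z" using huv y z by simp
      from alg_hom_kernel_diff[OF F.is_assoc_algebra Q hc, OF y(1) z(1) this]
      show "u = v" unfolding LJ y(2) z(2) by (intro Q.cls_eqI y z)
    qed
  qed
qed

section \<open>Adjoining a free variable\<close>

abbreviation adjoin ::
  "('k, 'm) ring_scheme \<Rightarrow> ('k, 'a, 'n) module_scheme \<Rightarrow>
    ('k, (('a + (unit list \<Rightarrow> 'k)) list \<Rightarrow> 'k) set) module"
  where "adjoin K A \<equiv> free_product K A (free_algebra K (UNIV :: unit set))"

abbreviation adjoin_inl ::
  "('k, 'm) ring_scheme \<Rightarrow> ('k, 'a, 'n) module_scheme \<Rightarrow> 'a \<Rightarrow>
    (('a + (unit list \<Rightarrow> 'k)) list \<Rightarrow> 'k) set"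
  where "adjoin_inl K A \<equiv> free_product_inl K A (free_algebra K (UNIV :: unit set))"

abbreviation adjoin_var ::
  "('k, 'm) ring_scheme \<Rightarrow> ('k, 'a, 'n) module_scheme \<Rightarrow>
    (('a + (unit list \<Rightarrow> 'k)) list \<Rightarrow> 'k) set"
  where "adjoin_var K A \<equiv> free_product_inr K A (free_algebra K (UNIV :: unit set)) (free_var K ())"

context
  fixes K :: "('k, 'm) ring_scheme" and A :: "('k, 'a, 'n) module_scheme"
  assumes A: "assoc_algebra K A"
begin

interpretation A: assoc_algebra K A by (rule A)

lemma unit_free_algebra: "assoc_algebra K (free_algebra K (UNIV :: unit set))"
  by (rule A.R.free_assoc_algebra)

lemma adjoin_assoc_algebra: "assoc_algebra K (adjoin K A)"
  by (rule free_product_assoc_algebra[OF A unit_free_algebra])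

lemma adjoin_inl_hom: "adjoin_inl K A \<in> alg_hom K A (adjoin K A)"
  by (rule free_product_inl_hom[OF A unit_free_algebra])

lemma adjoin_inr_hom:
  "free_product_inr K A (free_algebra K (UNIV :: unit set)) \<in>
    alg_hom K (free_algebra K (UNIV :: unit set)) (adjoin K A)"
  by (rule free_product_inr_hom[OF A unit_free_algebra])

lemma adjoin_var_closed: "adjoin_var K A \<in> carrier (adjoin K A)"
  by (intro alg_homD(1)[OF adjoin_inr_hom] free_var_carrier A.R.is_cring UNIV_I)

text \<open>The coproduct property combined with freeness: the element \<open>c\<close> corresponds
  to a homomorphism from \<open>K<x>\<close>, which is then joined with \<open>f\<close>.\<close>

lemma adjoin_hom_exists:
  assumes C: "assoc_algebra K C" and f: "f \<in> alg_hom K A C" and c: "c \<in> carrier C"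
  obtains h where "h \<in> alg_hom K (adjoin K A) C"
    "\<And>a. a \<in> carrier A \<Longrightarrow> h (adjoin_inl K A a) = f a" "h (adjoin_var K A) = c"
proof -
  have "(\<lambda>_::unit. c) ` UNIV \<subseteq> carrier C" using c by auto
  from free_algebra_universal[OF C this] obtain g
    where g: "g \<in> alg_hom K (free_algebra K (UNIV :: unit set)) C" "g (free_var K ()) = c" by auto
  from free_product_universal[OF A unit_free_algebra C f g(1)] obtain h
    where h: "h \<in> alg_hom K (adjoin K A) C" "\<forall>a\<in>carrier A. h (adjoin_inl K A a) = f a"
      "\<forall>b\<in>carrier (free_algebra K (UNIV :: unit set)).
        h (free_product_inr K A (free_algebra K UNIV) b) = g b" by blast
  have "h (adjoin_var K A) = c"
    using h(3) g(2) free_var_carrier[OF A.R.is_cring, of "()" UNIV] by simp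
  then show thesis using h(2) by (intro that[OF h(1)]) simp_all
qed

lemma adjoin_hom_unique:
  assumes C: "assoc_algebra K C"
    and g: "g \<in> alg_hom K (adjoin K A) C" and h: "h \<in> alg_hom K (adjoin K A) C"
    and inl: "\<And>a. a \<in> carrier A \<Longrightarrow> g (adjoin_inl K A a) = h (adjoin_inl K A a)"
    and var: "g (adjoin_var K A) = h (adjoin_var K A)"
    and x: "x \<in> carrier (adjoin K A)"
  shows "g x = h x"
proof -
  let ?X = "free_algebra K (UNIV :: unit set)"
  let ?r = "free_product_inr K A ?X"
  note gl = alg_hom_comp[OF adjoin_inl_hom g] and gr = alg_hom_comp[OF adjoin_inr_hom g]
    and hr = alg_hom_comp[OF adjoin_inr_hom h]
  have r: "(g \<circ> ?r) b = (h \<circ> ?r) b" if "b \<in> carrier ?X" for b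
    by (rule free_algebra_hom_unique[OF C gr hr _ that]) (simp add: var)
  \<comment> \<open>\<open>k\<close> is the map induced by the restrictions of \<open>g\<close> to
    the two factors. Both \<open>g\<close> and \<open>h\<close> have these restrictions, so both
    coincide with \<open>k\<close>.\<close>
  obtain k where "\<And>h' x. h' \<in> alg_hom K (adjoin K A) C \<Longrightarrow>
      (\<forall>a\<in>carrier A. h' (adjoin_inl K A a) = (g \<circ> adjoin_inl K A) a) \<Longrightarrow>
      (\<forall>b\<in>carrier ?X. h' (?r b) = (g \<circ> ?r) b) \<Longrightarrow> x \<in> carrier (adjoin K A) \<Longrightarrow> h' x = k x"
    using free_product_universal[OF A unit_free_algebra C gl gr] by blast
  from this[OF g _ _ x] this[OF h _ _ x] show ?thesis using inl r by simp
qed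

text \<open>Supplies the surjection required by \<open>countably_generated_copy\<close>. One
  additional generator is made room for by shifting the indices.\<close>

lemma adjoin_countably_generated:
  assumes p: "p \<in> alg_hom K (free_algebra K (UNIV :: nat set)) A"
    and surj: "p ` carrier (free_algebra K (UNIV :: nat set)) = carrier A"
  obtains e where "e ` carrier (free_algebra K (UNIV :: nat set)) = carrier (adjoin K A)"
proof -
  let ?F = "free_algebra K (UNIV :: nat set)" and ?X = "free_algebra K (UNIV :: unit set)"
  let ?r = "free_product_inr K A ?X"
  note P = adjoin_assoc_algebra
  have F: "assoc_algebra K ?F" by (rule A.R.free_assoc_algebra)
  have v: "free_var K n \<in> carrier ?F" for n by (intro free_var_carrier A.R.is_cring UNIV_I)
  \<comment> \<open>Generator 0 becomes the new variable, and generator \<open>Suc m\<close> takes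
    over the role that generator \<open>m\<close> has under \<open>p\<close>.\<close>
  define \<phi> where "\<phi> n = (case n of 0 \<Rightarrow> adjoin_var K A | Suc m \<Rightarrow> adjoin_inl K A (p (free_var K m)))" for n
  have "\<phi> ` UNIV \<subseteq> carrier (adjoin K A)"
    using adjoin_var_closed alg_homD(1)[OF adjoin_inl_hom] alg_homD(1)[OF p] v
    by (auto simp: \<phi>_def split: nat.split)
  from free_algebra_universal[OF P this] obtain e
    where e: "e \<in> alg_hom K ?F (adjoin K A)" and e\<phi>: "\<And>n. e (free_var K n) = \<phi> n" by auto
  have "(\<lambda>n. free_var K (Suc n)) ` UNIV \<subseteq> carrier ?F" using v by auto
  \<comment> \<open>The shift \<open>s\<close> is chosen so that \<open>e \<circ> s\<close> equals
    \<open>adjoin_inl K A \<circ> p\<close>; since \<open>p\<close> is onto, the image of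
    \<open>e\<close> contains the image of \<open>A\<close>. The map \<open>t\<close> below does the
    same for \<open>K<x>\<close>.\<close>
  from free_algebra_universal[OF F this] obtain s
    where s: "s \<in> alg_hom K ?F ?F" "\<And>n. s (free_var K n) = free_var K (Suc n)" by auto
  have "(\<lambda>_::unit. free_var K 0) ` UNIV \<subseteq> carrier ?F" using v by auto
  from free_algebra_universal[OF F this] obtain t
    where t: "t \<in> alg_hom K ?X ?F" "t (free_var K ()) = free_var K 0" by auto
  let ?S = "e ` carrier ?F"
  have inl: "adjoin_inl K A a \<in> ?S" if a: "a \<in> carrier A" for a
  proof -
    obtain q where q: "q \<in> carrier ?F" "a = p q" using surj a by blast
    have "(adjoin_inl K A \<circ> p) q = (e \<circ> s) q"
      by (rule free_algebra_hom_unique[OF P alg_hom_comp[OF p adjoin_inl_hom] alg_hom_comp[OF s(1) e] _ q(1)])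
        (simp add: s(2) e\<phi> \<phi>_def)
    then show ?thesis using alg_homD(1)[OF s(1) q(1)] q(2) by simp
  qed
  have inr: "?r b \<in> ?S" if b: "b \<in> carrier ?X" for b
  proof -
    have "?r b = (e \<circ> t) b"
      by (rule free_algebra_hom_unique[OF P adjoin_inr_hom alg_hom_comp[OF t(1) e] _ b])
        (simp add: t(2) e\<phi> \<phi>_def)
    then show ?thesis using alg_homD(1)[OF t(1) b] by simp
  qed
  let ?G = "free_product_generators K A ?X"
  interpret Q: quotient_setup K ?G "free_product_ideal K A ?X"
    by (rule free_product_setup(1)[OF A unit_free_algebra])
  have cls: "Q.cls \<in> alg_hom K ?G (adjoin K A)"
    unfolding free_product_def by (rule Q.cls_hom)
  have gen: "Q.cls (free_var K z) \<in> ?S" if "z \<in> carrier A <+> carrier ?X" for z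
    using that inl inr by (auto simp: free_product_inl_def free_product_inr_def)
  \<comment> \<open>Chosen preimages of the generating classes extend to a homomorphism
    \<open>u\<close> with \<open>e \<circ> u\<close> equal to the quotient map, so surjectivity of
    the latter passes to \<open>e\<close>.\<close>
  define \<sigma> where "\<sigma> z = (SOME q. q \<in> carrier ?F \<and> e q = Q.cls (free_var K z))" for z
  have \<sigma>: "\<sigma> z \<in> carrier ?F" "e (\<sigma> z) = Q.cls (free_var K z)" if "z \<in> carrier A <+> carrier ?X" for z
    using someI_ex[of "\<lambda>q. q \<in> carrier ?F \<and> e q = Q.cls (free_var K z)"] gen[OF that]
    unfolding \<sigma>_def by auto
  have "\<sigma> ` (carrier A <+> carrier ?X) \<subseteq> carrier ?F" using \<sigma> by blast
  from free_algebra_universal[OF F this] obtain u where u: "u \<in> alg_hom K ?G ?F"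
    and u\<sigma>: "\<And>z. z \<in> carrier A <+> carrier ?X \<Longrightarrow> u (free_var K z) = \<sigma> z" by blast
  have "y \<in> ?S" if "y \<in> carrier (adjoin K A)" for y
  proof -
    obtain w where w: "w \<in> carrier ?G" "y = Q.cls w"
      using Q.carrier_cls \<open>y \<in> carrier (adjoin K A)\<close> unfolding free_product_def by blast
    have "Q.cls w = (e \<circ> u) w"
      by (rule free_algebra_hom_unique[OF P cls alg_hom_comp[OF u e] _ w(1)]) (simp add: u\<sigma> \<sigma>)
    then show ?thesis using w(2) alg_homD(1)[OF u w(1)] by simp
  qed
  then have "?S = carrier (adjoin K A)" using alg_homD(1)[OF e] by blast
  then show thesis by (rule that)
qed

end

text \<open>Here \<open>B\<close> stands for \<open>A * K<y>\<close>, where \<open>y\<close>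
  corresponds to the variable under the given isomorphism, and \<open>adjoin K B\<close> for
  \<open>A * K<y, z>\<close>. The maps \<open>f\<close> and \<open>g\<close> realize the two
  substitutions between \<open>x\<close> and the pair \<open>y\<close>, \<open>z\<close>.\<close>

lemma leavitt_adjoin_twice:
  assumes A: "assoc_algebra K A" and B: "assoc_algebra K B"
    and rel: "leavitt_relations A a1 a2 b1 b2" and iso: "alg_isomorphic K (adjoin K A) B"
  shows "alg_isomorphic K (adjoin K A) (adjoin K B)"
proof -
  let ?P = "adjoin K A" and ?Q = "adjoin K B"
  let ?i = "adjoin_inl K A" and ?j = "adjoin_inl K B"
  let ?x = "adjoin_var K A" and ?z = "adjoin_var K B"
  note P = adjoin_assoc_algebra[OF A] and Q = adjoin_assoc_algebra[OF B]
  interpret P: assoc_algebra K ?P by (rule P)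
  interpret Q: assoc_algebra K ?Q by (rule Q)
  note i = adjoin_inl_hom[OF A] and j = adjoin_inl_hom[OF B]
  note x = adjoin_var_closed[OF A] and z = adjoin_var_closed[OF B]
  obtain \<theta> \<rho> where \<theta>: "\<theta> \<in> alg_hom K ?P B" and \<rho>: "\<rho> \<in> alg_hom K B ?P"
    and \<rho>\<theta>: "\<And>u. u \<in> carrier ?P \<Longrightarrow> \<rho> (\<theta> u) = u" and \<theta>\<rho>: "\<And>b. b \<in> carrier B \<Longrightarrow> \<theta> (\<rho> b) = b"
    using alg_isomorphic_obtain[OF P iso] by metis
  let ?y = "?j (\<theta> ?x)"
  \<comment> \<open>The copy of \<open>A\<close> inside \<open>A * K<y, z>\<close>.\<close>
  define k where "k = ?j \<circ> \<theta> \<circ> ?i"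
  have k: "k \<in> alg_hom K A ?Q"
    unfolding k_def by (rule alg_hom_comp[OF i alg_hom_comp[OF \<theta> j]])
  have y: "?y \<in> carrier ?Q" by (intro alg_homD(1)[OF j] alg_homD(1)[OF \<theta>] x)
  note iD = alg_homD[OF i] and kD = alg_homD[OF k]
  have mem: "a1 \<in> carrier A" "a2 \<in> carrier A" "b1 \<in> carrier A" "b2 \<in> carrier A"
    using rel by (auto simp: leavitt_relations_def)
  note imem = mem[THEN iD(1)] and kmem = mem[THEN kD(1)]
  have irel: "leavitt_relations ?P (?i a1) (?i a2) (?i b1) (?i b2)"
    by (rule leavitt_relations_hom[OF A P i rel])
  have krel: "leavitt_relations ?Q (k a1) (k a2) (k b1) (k b2)"
    by (rule leavitt_relations_hom[OF A Q k rel])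
  obtain f where f: "f \<in> alg_hom K ?P ?Q" and fi: "\<And>a. a \<in> carrier A \<Longrightarrow> f (?i a) = k a"
    and fx: "f ?x = k a1 \<otimes>\<^bsub>?Q\<^esub> ?y \<oplus>\<^bsub>?Q\<^esub> k a2 \<otimes>\<^bsub>?Q\<^esub> ?z"
    using adjoin_hom_exists[OF A Q k, of "k a1 \<otimes>\<^bsub>?Q\<^esub> ?y \<oplus>\<^bsub>?Q\<^esub> k a2 \<otimes>\<^bsub>?Q\<^esub> ?z"] y z kmem by auto
  \<comment> \<open>A map out of \<open>adjoin K B\<close> has to be prescribed on all of
    \<open>B\<close>. The substitution of \<open>b1 x\<close> for the variable is therefore made on
    \<open>?P\<close> first and carried to \<open>B\<close> along \<open>\<rho>\<close>.\<close>
  obtain g0 where g0: "g0 \<in> alg_hom K ?P ?P" and g0i: "\<And>a. a \<in> carrier A \<Longrightarrow> g0 (?i a) = ?i a"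
    and g0x: "g0 ?x = ?i b1 \<otimes>\<^bsub>?P\<^esub> ?x"
    using adjoin_hom_exists[OF A P i, of "?i b1 \<otimes>\<^bsub>?P\<^esub> ?x"] x imem by auto
  obtain g where g: "g \<in> alg_hom K ?Q ?P" and gj: "\<And>b. b \<in> carrier B \<Longrightarrow> g (?j b) = g0 (\<rho> b)"
    and gz: "g ?z = ?i b2 \<otimes>\<^bsub>?P\<^esub> ?x"
    using adjoin_hom_exists[OF B P alg_hom_comp[OF \<rho> g0], of "?i b2 \<otimes>\<^bsub>?P\<^esub> ?x"] x imem by auto
  have gj\<theta>: "g (?j (\<theta> u)) = g0 u" if "u \<in> carrier ?P" for u
    using gj[OF alg_homD(1)[OF \<theta> that]] \<rho>\<theta>[OF that] by simp
  have gk: "g (k a) = ?i a" if "a \<in> carrier A" for a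
    using gj\<theta>[OF iD(1)[OF that]] g0i[OF that] by (simp add: k_def)
  have gy: "g ?y = ?i b1 \<otimes>\<^bsub>?P\<^esub> ?x" using gj\<theta>[OF x] g0x by simp
  note gD = alg_homD[OF g] and fD = alg_homD[OF f]
  have gfx: "g (f ?x) = ?x"
  proof -
    have "g (f ?x) = ?i a1 \<otimes>\<^bsub>?P\<^esub> (?i b1 \<otimes>\<^bsub>?P\<^esub> ?x) \<oplus>\<^bsub>?P\<^esub> ?i a2 \<otimes>\<^bsub>?P\<^esub> (?i b2 \<otimes>\<^bsub>?P\<^esub> ?x)"
      using y z kmem mem by (simp add: fx gD gk gy gz)
    also have "\<dots> = (?i a1 \<otimes>\<^bsub>?P\<^esub> ?i b1 \<oplus>\<^bsub>?P\<^esub> ?i a2 \<otimes>\<^bsub>?P\<^esub> ?i b2) \<otimes>\<^bsub>?P\<^esub> ?x"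
      using x imem by (simp add: P.M.l_distr P.M.m_assoc)
    also have "\<dots> = ?x" using irel x by (simp add: leavitt_relations_def)
    finally show ?thesis .
  qed
  \<comment> \<open>With \<open>b1\<close> for \<open>b\<close> the relations leave only
    \<open>?y\<close>, and with \<open>b2\<close> only \<open>?z\<close>.\<close>
  have red: "k b \<otimes>\<^bsub>?Q\<^esub> f ?x =
      (k b \<otimes>\<^bsub>?Q\<^esub> k a1) \<otimes>\<^bsub>?Q\<^esub> ?y \<oplus>\<^bsub>?Q\<^esub> (k b \<otimes>\<^bsub>?Q\<^esub> k a2) \<otimes>\<^bsub>?Q\<^esub> ?z" if "b \<in> carrier A" for b
    using y z kmem kD(1)[OF that] by (simp add: fx Q.M.r_distr Q.M.m_assoc)
  have fgz: "f (g ?z) = ?z"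
    using red[OF mem(4)] krel y z x imem mem by (simp add: gz fD fi leavitt_relations_def)
  have fgy: "f (g ?y) = ?y"
    using red[OF mem(3)] krel y z x imem mem by (simp add: gy fD fi leavitt_relations_def)
  \<comment> \<open>That \<open>f \<circ> g\<close> fixes \<open>B\<close> is tested on
    \<open>?P\<close>, where a homomorphism is determined by \<open>A\<close> and the variable;
    taking \<open>u\<close> to be \<open>\<rho> b\<close> returns to \<open>B\<close>.\<close>
  have fg0: "(f \<circ> g0) u = (?j \<circ> \<theta>) u" if "u \<in> carrier ?P" for u
    by (rule adjoin_hom_unique[OF A Q alg_hom_comp[OF g0 f] alg_hom_comp[OF \<theta> j] _ _ that])
      (use fgy gj\<theta>[OF x] in \<open>simp_all add: g0i fi k_def\<close>)
  have "(g \<circ> f) u = u" if "u \<in> carrier ?P" for u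
    by (rule adjoin_hom_unique[OF A P alg_hom_comp[OF f g] alg_hom_id _ _ that])
      (simp_all add: fi gk gfx)
  moreover have "(f \<circ> g) u = u" if "u \<in> carrier ?Q" for u
  proof (rule adjoin_hom_unique[OF B Q alg_hom_comp[OF g f] alg_hom_id _ _ that])
    fix b assume b: "b \<in> carrier B"
    show "(f \<circ> g) (?j b) = ?j b"
      using fg0[OF alg_homD(1)[OF \<rho> b]] gj[OF b] \<theta>\<rho>[OF b] by simp
  qed (simp add: fgz)
  ultimately show ?thesis by (intro alg_isomorphicI[OF f g]) simp_all
qed

theorem theorem1p7:
  fixes K :: "('k, 'm) ring_scheme"
  assumes "field K"
  shows "\<exists>(A :: ('k, (nat list \<Rightarrow> 'k) set) module) (B :: ('k, (nat list \<Rightarrow> 'k) set) module).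
    assoc_algebra K A \<and> assoc_algebra K B \<and>
    \<not> alg_isomorphic K A B \<and>
    alg_isomorphic K (free_product K A (free_algebra K (UNIV :: unit set)))
                     (free_product K B (free_algebra K (UNIV :: unit set)))"
proof -
  obtain A :: "('k, (nat list \<Rightarrow> 'k) set) module" and a1 a2 b1 b2 p
    where A: "assoc_algebra K A" and ne: "\<one>\<^bsub>A\<^esub> \<noteq> \<zero>\<^bsub>A\<^esub>" and rel: "leavitt_relations A a1 a2 b1 b2"
      and p: "p \<in> alg_hom K (free_algebra K (UNIV :: nat set)) A"
        "p ` carrier (free_algebra K (UNIV :: nat set)) = carrier A"
      and simple: "\<And>e. e \<in> alg_hom K A A \<Longrightarrow> inj_on e (carrier A)"
    using simple_leavitt_algebra[OF assms] by metis
  interpret A: assoc_algebra K A by (rule A)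
  let ?P = "adjoin K A" and ?x = "adjoin_var K A"
  have P: "assoc_algebra K ?P" by (rule adjoin_assoc_algebra[OF A])
  interpret P: assoc_algebra K ?P by (rule P)
  obtain e where "e ` carrier (free_algebra K (UNIV :: nat set)) = carrier ?P"
    using adjoin_countably_generated[OF A p] .
  \<comment> \<open>\<open>A * K<x>\<close> itself lives on a larger type, so \<open>B\<close> is a
    copy of it on the type of \<open>A\<close>.\<close>
  from countably_generated_copy[OF P this] obtain B :: "('k, (nat list \<Rightarrow> 'k) set) module"
    where B: "assoc_algebra K B" and iso: "alg_isomorphic K ?P B" by blast
  have "\<not> alg_isomorphic K A B"
  proof
    assume "alg_isomorphic K A B"
    then obtain f g where f: "f \<in> alg_hom K A B" and g: "g \<in> alg_hom K B A"
      and fg: "\<And>b. b \<in> carrier B \<Longrightarrow> f (g b) = b"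
      using alg_isomorphic_obtain[OF A] by metis
    obtain \<theta> \<rho> where \<theta>: "\<theta> \<in> alg_hom K ?P B" and \<rho>: "\<rho> \<in> alg_hom K B ?P"
      and \<rho>\<theta>: "\<And>u. u \<in> carrier ?P \<Longrightarrow> \<rho> (\<theta> u) = u"
      using alg_isomorphic_obtain[OF P iso] by metis
    obtain h0 where h0: "h0 \<in> alg_hom K ?P A" "h0 ?x = \<zero>\<^bsub>A\<^esub>"
      using adjoin_hom_exists[OF A A alg_hom_id, of "\<zero>\<^bsub>A\<^esub>"] by (metis A.M.zero_closed)
    \<comment> \<open>Sending the variable to \<open>\<one>\<close> shows that it is nonzero, as
      \<open>A\<close> is nontrivial.\<close>
    obtain h1 where h1: "h1 \<in> alg_hom K ?P A" "h1 ?x = \<one>\<^bsub>A\<^esub>"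
      using adjoin_hom_exists[OF A A alg_hom_id, of "\<one>\<^bsub>A\<^esub>"] by (metis A.M.one_closed)
    have x: "?x \<in> carrier ?P" by (rule adjoin_var_closed[OF A])
    \<comment> \<open>An isomorphism from \<open>A\<close> to \<open>B\<close>, followed by
      \<open>\<rho>\<close> and the evaluation at zero, is an endomorphism of \<open>A\<close>,
      hence injective; yet \<open>h0\<close> identifies the variable with zero.\<close>
    have inj: "inj_on (h0 \<circ> (\<rho> \<circ> f)) (carrier A)"
      by (rule simple[OF alg_hom_comp[OF alg_hom_comp[OF f \<rho>] h0(1)]])
    have gf: "\<rho> (f (g (\<theta> u))) = u" "g (\<theta> u) \<in> carrier A" if "u \<in> carrier ?P" for u
      using that by (simp_all only: fg \<rho>\<theta> alg_homD(1)[OF \<theta>] alg_homD(1)[OF g])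
    have "g (\<theta> ?x) = g (\<theta> \<zero>\<^bsub>?P\<^esub>)"
      by (rule inj_onD[OF inj])
        (simp_all only: comp_apply gf x P.M.zero_closed h0(2) alg_hom_zero[OF P A h0(1)])
    then have "?x = \<zero>\<^bsub>?P\<^esub>" using gf(1)[OF x] gf(1)[OF P.M.zero_closed] by metis
    then show False using ne h1(2) alg_hom_zero[OF P A h1(1)] by metis
  qed
  moreover have "alg_isomorphic K ?P (adjoin K B)"
    by (rule leavitt_adjoin_twice[OF A B rel iso])
  ultimately show ?thesis using A B by blast
qed

end
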